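(* Let $K:\mathbb{R}\to\mathbb{R}\cup\{\infty\}$ be a function which may be infinite only at $t=0$ and which satisfies: (I)(a) $K\in L^1_{loc}(\mathbb{R})$, $K$ is symmetric around zero, and $K(t)>0$ for all $t\neq 0$; (I)(b) $K(t)\to 0$ as $t\to\infty$ and $K$ is eventually decreasing; (I)(c) the improper integral $\mathcal{K}_{\cos}(\omega)=\int_0^\infty K(t)\cos(\omega t)\,dt$ is positive for all $\omega\neq 0$; (II) $K(t)\sim t^{-1}$ as $t\to\infty$. Let $V$ be the weak solution of the generalized Langevin equation $$m\dot V(t)=-\beta\int_{-\infty}^t K(t-s)V(s)\,ds+\sqrt{\beta}\,F(t),\qquad m,\beta>0,$$ that is, the operator whose spectral measure is $\nu(d\omega)=\widehat r(\omega)\,d\omega$ with $$\widehat r(\omega)=\frac{1}{2\pi}\,\frac{2\beta\mathcal{K}_{\cos}(\omega)}{[\beta\mathcal{K}_{\cos}(\omega)]^2+[m\omega-\beta\mathcal{K}_{\sin}(\omega)]^2},$$ and let $X(t)=\langle V,1_{[0,t]}\rangle$ be the associated position process. Then $$\mathbb{E}[X(t)^2]\sim\frac{t}{\log(t)},\qquad t\to\infty.$$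
   Context: Notation: $f(t)\sim g(t)$ as $t\to\infty$ means $f(t)/g(t)\to c$ for some constant $c\in(0,\infty)$ (not necessarily $1$); similarly for other limits. $\mathcal{K}_{\cos}(\omega)=\int_0^\infty K(t)\cos(t\omega)\,dt$ and $\mathcal{K}_{\sin}(\omega)=\int_0^\infty K(t)\sin(t\omega)\,dt$ are improper integrals. "Eventually decreasing" means decreasing on $[A,\infty)$ for some $A$. $m>0$ and $\beta>0$ are constants. Fourier conventions: $\widehat\varphi(\omega)=\int_{\mathbb{R}}e^{it\omega}\varphi(t)\,dt$. $\mathcal{S}$ is the Schwartz space, $\mathcal{S}'$ the tempered distributions, $\mathcal{F}[g]$ the Fourier transform of $g\in\mathcal{S}'$, defined by $\langle\mathcal{F}[g],\varphi\rangle=\langle g,\widehat\varphi\rangle$. Operator with spectral measure $\nu$: let $\nu$ be a non-negative measure on $\mathbb{R}$, absolutely continuous with respect to Lebesgue measure, with $\int_{\mathbb{R}}(1+x^2)^{-k}\nu(dx)<\infty$ for some integer $k$. The operator $V$ associated with $\nu$ is a linear map from $\mathrm{Dom}(V)$ to square-integrable complex-valued Gaussian random variables, where $\mathrm{Dom}(V)$ is the set of $g\in\mathcal{S}'$ such that $\mathcal{F}[g]$ is a complex-valued function belonging to $L^2(\nu)$, and $$\mathbb{E}\big[\langle V,g_1\rangle\overline{\langle V,g_2\rangle}\big]=\int_{\mathbb{R}}\mathcal{F}[g_1](\omega)\overline{\mathcal{F}[g_2](\omega)}\,\nu(d\omega),\qquad g_1,g_2\in\mathrm{Dom}(V).$$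 Weak solution: let $K^+(t)=K(t)1_{\{t\ge0\}}$ and $\widetilde f(x)=f(-x)$, so $\widetilde{K^+*\widetilde\varphi}(t)=\int_{\mathbb{R}}K^+(u)\varphi(t+u)\,du$. The noise $F$ is the stationary random distribution on $\mathcal{S}$ with $\mathbb{E}[\langle F,\varphi_1\rangle\overline{\langle F,\varphi_2\rangle}]=\int_{\mathbb{R}}K(t)(\varphi_1*\varphi_2^{*})(t)\,dt$, $\varphi_2^*(t)=\overline{\varphi_2(-t)}$. $V$ is a weak solution of the equation if (a) $K^+*\varphi\in\mathrm{Dom}(V)$ for every $\varphi\in\mathcal{S}$, and (b) for all $\varphi,\psi\in\mathcal{S}$, $\mathbb{E}\big[\langle V,-m\varphi'+\beta\widetilde{K^+*\widetilde\varphi}\rangle\overline{\langle V,-m\psi'+\beta\widetilde{K^+*\widetilde\psi}\rangle}\big]=\mathbb{E}\big[\langle\sqrt\beta F,\varphi\rangle\overline{\langle\sqrt\beta F,\psi\rangle}\big]$. Under the hypotheses (I) and (II), weak solutions are exactly the operators with spectral measure $\widehat r(\omega)\,d\omega$. In particular $\mathbb{E}[X(t)^2]=\int_{\mathbb{R}}|\widehat{1_{[0,t]}}(\omega)|^2\,\widehat r(\omega)\,d\omega$. *)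

theory Defs
  imports "HOL-Probability.Probability"
begin

definition asymp_const :: "(real \<Rightarrow> real) \<Rightarrow> (real \<Rightarrow> real) \<Rightarrow> bool" (infix \<open>\<asymp>\<^sub>c\<close> 50)
  where "f \<asymp>\<^sub>c g \<longleftrightarrow> (\<exists>c>0. ((\<lambda>t. f t / g t) \<longlongrightarrow> c) at_top)"

text \<open>
  A kernel has values in the extended reals; in integrals, its value at \<open>0\<close>, the only point where
  it may be infinite, is irrelevant. The improper integrals are limits of
  absolutely convergent integrals over bounded intervals. For locally integrable kernels that
  eventually decrease to \<open>0\<close>, they exist for all \<open>\<omega> \<noteq> 0\<close> by Dirichlet's test. At \<open>\<omega> = 0\<close> the cosine
  integral may diverge, and then its value is unspecified.
\<close>

definition K_cos :: "(real \<Rightarrow> ereal) \<Rightarrow> real \<Rightarrow> real" where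
  "K_cos K \<omega> = Lim at_top (\<lambda>T. integral {0..T} (\<lambda>t. real_of_ereal (K t) * cos (t * \<omega>)))"

definition K_sin :: "(real \<Rightarrow> ereal) \<Rightarrow> real \<Rightarrow> real" where
  "K_sin K \<omega> = Lim at_top (\<lambda>T. integral {0..T} (\<lambda>t. real_of_ereal (K t) * sin (t * \<omega>)))"

definition r_hat :: "real \<Rightarrow> real \<Rightarrow> (real \<Rightarrow> ereal) \<Rightarrow> real \<Rightarrow> real" where
  "r_hat m \<beta> K \<omega> = 1 / (2 * pi) *
     (2 * \<beta> * K_cos K \<omega> / ((\<beta> * K_cos K \<omega>)\<^sup>2 + (m * \<omega> - \<beta> * K_sin K \<omega>)\<^sup>2))"

definition locally_integrable :: "(real \<Rightarrow> real) \<Rightarrow> bool" where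
  "locally_integrable f \<longleftrightarrow> (\<forall>a b. f absolutely_integrable_on {a..b})"


definition vderiv :: "(real \<Rightarrow> complex) \<Rightarrow> real \<Rightarrow> complex" where
  "vderiv \<phi> = (\<lambda>t. vector_derivative \<phi> (at t))"

definition schwartz :: "(real \<Rightarrow> complex) set" where
  "schwartz = {\<phi>. (\<forall>n t. (vderiv ^^ n) \<phi> differentiable at t) \<and>
                  (\<forall>k n. bounded (range (\<lambda>t. t ^ k *\<^sub>R (vderiv ^^ n) \<phi> t)))}"

definition schwartz_seminorm :: "nat \<Rightarrow> nat \<Rightarrow> (real \<Rightarrow> complex) \<Rightarrow> real" where
  "schwartz_seminorm k n \<phi> = (SUP t. norm (t ^ k *\<^sub>R (vderiv ^^ n) \<phi> t))"

text \<open>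
  Functionals on the Schwartz space are represented by functions that are \<open>undefined\<close> off
  \<open>schwartz\<close>, so that HOL equality is equality of functionals.
\<close>

type_synonym functional = "(real \<Rightarrow> complex) \<Rightarrow> complex"

definition tempered_distributions :: "functional set" where
  "tempered_distributions = {g \<in> extensional schwartz.
     (\<forall>\<phi>\<in>schwartz. \<forall>\<psi>\<in>schwartz. \<forall>a b. g (\<lambda>t. a * \<phi> t + b * \<psi> t) = a * g \<phi> + b * g \<psi>) \<and>
     (\<exists>C N. \<forall>\<phi>\<in>schwartz. norm (g \<phi>) \<le> C * (\<Sum>k\<le>N. \<Sum>n\<le>N. schwartz_seminorm k n \<phi>))}"

definition lincomb :: "complex \<Rightarrow> functional \<Rightarrow> complex \<Rightarrow> functional \<Rightarrow> functional" where
  "lincomb a g b h = (\<lambda>\<phi>\<in>schwartz. a * g \<phi> + b * h \<phi>)"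

definition distribution_of :: "(real \<Rightarrow> complex) \<Rightarrow> functional" where
  "distribution_of h = (\<lambda>\<phi>\<in>schwartz. LINT t|lborel. h t * \<phi> t)"

definition is_function :: "functional \<Rightarrow> (real \<Rightarrow> complex) \<Rightarrow> bool" where
  "is_function g h \<longleftrightarrow> h \<in> borel_measurable borel \<and>
     (\<forall>\<phi>\<in>schwartz. integrable lborel (\<lambda>t. h t * \<phi> t)) \<and> g = distribution_of h"

definition fourier :: "(real \<Rightarrow> complex) \<Rightarrow> real \<Rightarrow> complex" where
  "fourier \<phi> \<omega> = (LINT t|lborel. exp (\<i> * complex_of_real (t * \<omega>)) * \<phi> t)"

definition fourier_distribution :: "functional \<Rightarrow> functional" where
  "fourier_distribution g = (\<lambda>\<phi>\<in>schwartz. g (fourier \<phi>))"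


definition real_gaussian :: "'w measure \<Rightarrow> ('w \<Rightarrow> real) \<Rightarrow> bool" where
  "real_gaussian M Y \<longleftrightarrow> Y \<in> borel_measurable M \<and>
     ((\<exists>\<mu>. AE w in M. Y w = \<mu>) \<or>
      (\<exists>\<mu> \<sigma>. \<sigma> > 0 \<and> distributed M lborel Y (\<lambda>x. ennreal (normal_density \<mu> \<sigma> x))))"

text \<open>
  \<open>Z\<close> is a complex Gaussian variable if \<open>(Re Z, Im Z)\<close> is jointly Gaussian. Degenerate laws are
  allowed, and neither circular symmetry nor zero mean is imposed.
\<close>

definition complex_gaussian :: "'w measure \<Rightarrow> ('w \<Rightarrow> complex) \<Rightarrow> bool" where
  "complex_gaussian M Z \<longleftrightarrow> Z \<in> borel_measurable M \<and>
     (\<forall>a b. real_gaussian M (\<lambda>w. a * Re (Z w) + b * Im (Z w)))"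


definition admissible_spectral_measure :: "real measure \<Rightarrow> bool" where
  "admissible_spectral_measure \<nu> \<longleftrightarrow> sets \<nu> = sets borel \<and> absolutely_continuous lborel \<nu> \<and>
     (\<exists>k::int. integrable \<nu> (\<lambda>x. (1 + x\<^sup>2) powi (- k)))"

definition L2 :: "real measure \<Rightarrow> (real \<Rightarrow> complex) set" where
  "L2 \<nu> = {h \<in> borel_measurable \<nu>. integrable \<nu> (\<lambda>\<omega>. (norm (h \<omega>))\<^sup>2)}"

definition operator_domain :: "real measure \<Rightarrow> functional set" where
  "operator_domain \<nu> =
     {g \<in> tempered_distributions. \<exists>h. is_function (fourier_distribution g) h \<and> h \<in> L2 \<nu>}"

text \<open>
  The function representing a Fourier transform is unique up to Lebesgue null sets, which are
  \<open>\<nu>\<close>-null; hence the covariance condition may quantify over all representatives.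
  Random variables are identified when almost surely equal, so linearity is almost sure.
\<close>

definition operator_with_spectral_measure ::
    "'w measure \<Rightarrow> real measure \<Rightarrow> (functional \<Rightarrow> 'w \<Rightarrow> complex) \<Rightarrow> bool" where
  "operator_with_spectral_measure M \<nu> V \<longleftrightarrow>
     prob_space M \<and> admissible_spectral_measure \<nu> \<and>
     (\<forall>g\<in>operator_domain \<nu>. complex_gaussian M (V g) \<and> integrable M (\<lambda>w. (norm (V g w))\<^sup>2)) \<and>
     (\<forall>g\<^sub>1\<in>operator_domain \<nu>. \<forall>g\<^sub>2\<in>operator_domain \<nu>. \<forall>a b.
        AE w in M. V (lincomb a g\<^sub>1 b g\<^sub>2) w = a * V g\<^sub>1 w + b * V g\<^sub>2 w) \<and>
     (\<forall>g\<^sub>1\<in>operator_domain \<nu>. \<forall>g\<^sub>2\<in>operator_domain \<nu>. \<forall>h\<^sub>1\<in>L2 \<nu>. \<forall>h\<^sub>2\<in>L2 \<nu>.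
        is_function (fourier_distribution g\<^sub>1) h\<^sub>1 \<longrightarrow> is_function (fourier_distribution g\<^sub>2) h\<^sub>2 \<longrightarrow>
        (LINT w|M. V g\<^sub>1 w * cnj (V g\<^sub>2 w)) = (LINT \<omega>|\<nu>. h\<^sub>1 \<omega> * cnj (h\<^sub>2 \<omega>)))"

definition position_process :: "(functional \<Rightarrow> 'w \<Rightarrow> complex) \<Rightarrow> real \<Rightarrow> 'w \<Rightarrow> complex" where
  "position_process V t = V (distribution_of (indicator {0..t}))"

end

theory Submission
  imports Defs "HOL-Real_Asymp.Real_Asymp"
begin

text \<open>
  Since \<open>K\<close> decays like \<open>c / t\<close>, splitting the oscillatory integrals at \<open>t = 1 / \<bar>\<omega>\<bar>\<close> shows that, as
  \<open>\<omega>\<close> tends to \<open>0\<close>, the cosine transform grows like \<open>c ln (1 / \<bar>\<omega>\<bar>)\<close> while the sine transform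
  stays bounded. Hence the spectral density behaves like \<open>1 / (\<pi> \<beta> c ln (1 / \<bar>\<omega>\<bar>))\<close> near \<open>0\<close>. The
  variance of the position is the integral of this density against the Fejer-type kernel
  \<open>2 (1 - cos (t \<omega>)) / \<omega>\<^sup>2\<close>; substituting \<open>\<omega> = x / t\<close> and applying dominated convergence
  gives \<open>t / ln t\<close>, frequencies away from \<open>0\<close> contributing only a bounded amount.
\<close>

section \<open>The Fourier transform on the Schwartz space\<close>

text \<open>The covariance formula applies only to members of \<open>operator_domain\<close>, so the
  Fourier transform of an indicator has to be identified as a distribution; this explains the
  groundwork on Schwartz functions. The obstacle in the asymptotics is that the logarithm is not
  scale invariant: at \<omega> = x / t it equals \<open>ln t - ln \<bar>x\<bar>\<close>, and the
  correction, negligible for fixed x, is unbounded in x. The price is a factor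
  \<open>1 + max 0 (ln \<bar>x\<bar>)\<close> in the majorant, which the quadratic decay of the
  kernel absorbs. On the spectral side, the cosine transform outgrows \<open>m * \<omega>\<close> as
  well as the sine transform near 0, so inertia does not enter the leading order. At high
  frequencies the roles change: there \<open>m * \<omega>\<close> keeps the denominator away from 0.
  At intermediate frequencies local integrability of the density suffices, and it comes from the
  admissibility of the spectral measure.\<close>

lemma vderiv_eqI: "(f has_vector_derivative f') (at t) \<Longrightarrow> vderiv f t = f'"
  by (simp add: vderiv_def vector_derivative_at)

lemma has_vderiv: "f differentiable at t \<Longrightarrow> (f has_vector_derivative vderiv f t) (at t)"
  by (simp add: vderiv_def vector_derivative_works)

lemma schwartz_differentiable: "\<phi> \<in> schwartz \<Longrightarrow> (vderiv ^^ n) \<phi> differentiable at t"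
  and schwartz_bounded: "\<phi> \<in> schwartz \<Longrightarrow> bounded (range (\<lambda>t. t ^ k *\<^sub>R (vderiv ^^ n) \<phi> t))"
  by (auto simp: schwartz_def)

lemma schwartz_has_vderiv: "\<phi> \<in> schwartz \<Longrightarrow> (\<phi> has_vector_derivative vderiv \<phi> t) (at t)"
  using schwartz_differentiable[of \<phi> 0] by (simp add: has_vderiv)

lemma schwartz_continuous: "\<phi> \<in> schwartz \<Longrightarrow> isCont \<phi> t"
  using schwartz_has_vderiv has_vector_derivative_continuous by blast

lemma schwartz_measurable [measurable]: "\<phi> \<in> schwartz \<Longrightarrow> \<phi> \<in> borel_measurable borel"
  by (intro borel_measurable_continuous_onI) (auto simp: continuous_on_eq_continuous_at schwartz_continuous)

lemma schwartz_vderiv: "\<phi> \<in> schwartz \<Longrightarrow> vderiv \<phi> \<in> schwartz"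
  unfolding schwartz_def
proof safe
  fix n t assume "\<forall>n t. (vderiv ^^ n) \<phi> differentiable at t"
  then have "(vderiv ^^ Suc n) \<phi> differentiable at t" by blast
  then show "(vderiv ^^ n) (vderiv \<phi>) differentiable at t"
    by (simp add: funpow_swap1)
next
  fix k n assume "\<forall>k n. bounded (range (\<lambda>t. t ^ k *\<^sub>R (vderiv ^^ n) \<phi> t))"
  then have "bounded (range (\<lambda>t. t ^ k *\<^sub>R (vderiv ^^ Suc n) \<phi> t))" by blast
  then show "bounded (range (\<lambda>t. t ^ k *\<^sub>R (vderiv ^^ n) (vderiv \<phi>) t))"
    by (simp add: funpow_swap1)
qed

lemma vderiv_funpow_lincomb:
  assumes "\<phi> \<in> schwartz" "\<psi> \<in> schwartz"
  shows "(vderiv ^^ n) (\<lambda>t. a * \<phi> t + b * \<psi> t) =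
    (\<lambda>t. a * (vderiv ^^ n) \<phi> t + b * (vderiv ^^ n) \<psi> t)"
proof (induction n)
  case (Suc n)
  have "vderiv (\<lambda>t. a * (vderiv ^^ n) \<phi> t + b * (vderiv ^^ n) \<psi> t) t =
        a * (vderiv ^^ Suc n) \<phi> t + b * (vderiv ^^ Suc n) \<psi> t" for t
    using assms[THEN schwartz_differentiable, of n t, THEN has_vderiv]
    by (intro vderiv_eqI has_vector_derivative_add has_vector_derivative_mult_right) simp_all
  then show ?case by (simp add: Suc)
qed simp

lemma bounded_range_lincomb:
  fixes f g :: "'a \<Rightarrow> complex"
  assumes "bounded (range f)" "bounded (range g)"
  shows "bounded (range (\<lambda>t. a * f t + b * g t))"
proof -
  obtain B C where "\<And>t. norm (f t) \<le> B" "\<And>t. norm (g t) \<le> C"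
    using assms by (auto simp: bounded_iff)
  then have "norm (a * f t + b * g t) \<le> norm a * B + norm b * C" for t
    by (intro norm_triangle_le add_mono) (auto simp: norm_mult intro: mult_left_mono)
  then show ?thesis by (auto simp: bounded_iff)
qed

lemma schwartz_lincomb:
  assumes "\<phi> \<in> schwartz" "\<psi> \<in> schwartz"
  shows "(\<lambda>t. a * \<phi> t + b * \<psi> t) \<in> schwartz"
  unfolding schwartz_def mem_Collect_eq vderiv_funpow_lincomb[OF assms]
proof (intro conjI allI)
  fix k n
  have "(\<lambda>t. t ^ k *\<^sub>R (a * (vderiv ^^ n) \<phi> t + b * (vderiv ^^ n) \<psi> t)) =
        (\<lambda>t. a * (t ^ k *\<^sub>R (vderiv ^^ n) \<phi> t) + b * (t ^ k *\<^sub>R (vderiv ^^ n) \<psi> t))"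
    by (simp add: algebra_simps)
  then show "bounded (range (\<lambda>t. t ^ k *\<^sub>R (a * (vderiv ^^ n) \<phi> t + b * (vderiv ^^ n) \<psi> t)))"
    by (simp only: bounded_range_lincomb[OF assms[THEN schwartz_bounded]])
next
  fix n t
  show "(\<lambda>t. a * (vderiv ^^ n) \<phi> t + b * (vderiv ^^ n) \<psi> t) differentiable at t"
    using assms[THEN schwartz_differentiable, of n t]
    by (intro differentiable_add differentiable_mult differentiable_const)
qed

lemma schwartz_cmult: "\<phi> \<in> schwartz \<Longrightarrow> (\<lambda>t. a * \<phi> t) \<in> schwartz"
  using schwartz_lincomb[of \<phi> \<phi> a 0] by simp

text \<open>Leibniz rule in which two terms survive, because the second derivative of t is 0. For n
  = 0 the truncated index \<open>n - 1\<close> is harmless: its coefficient \<open>of_nat n\<close>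
  vanishes.\<close>

lemma vderiv_funpow_ident_mult:
  assumes "\<phi> \<in> schwartz"
  shows "(vderiv ^^ n) (\<lambda>t. of_real t * \<phi> t) =
    (\<lambda>t. of_real t * (vderiv ^^ n) \<phi> t + of_nat n * (vderiv ^^ (n - 1)) \<phi> t)"
proof (induction n)
  case (Suc n)
  have "vderiv (\<lambda>t. of_real t * (vderiv ^^ n) \<phi> t + of_nat n * (vderiv ^^ (n - 1)) \<phi> t) t =
        of_real t * (vderiv ^^ Suc n) \<phi> t + of_nat (Suc n) * (vderiv ^^ n) \<phi> t" for t
  proof (rule vderiv_eqI)
    have "((\<lambda>t. of_real t * (vderiv ^^ n) \<phi> t + of_nat n * (vderiv ^^ (n - 1)) \<phi> t) has_vector_derivative
       (of_real t * (vderiv ^^ Suc n) \<phi> t + 1 * (vderiv ^^ n) \<phi> t) + of_nat n * (vderiv ^^ Suc (n - 1)) \<phi> t) (at t)"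
      using schwartz_differentiable[OF assms, of _ t, THEN has_vderiv]
        has_vector_derivative_of_real[OF DERIV_ident, of "at t", unfolded of_real_1]
      by (intro has_vector_derivative_mult has_vector_derivative_add has_vector_derivative_mult_right)
        simp_all
    then show "((\<lambda>t. of_real t * (vderiv ^^ n) \<phi> t + of_nat n * (vderiv ^^ (n - 1)) \<phi> t) has_vector_derivative
       of_real t * (vderiv ^^ Suc n) \<phi> t + of_nat (Suc n) * (vderiv ^^ n) \<phi> t) (at t)"
      by (cases n) (simp_all add: algebra_simps)
  qed
  then show ?case by (simp add: Suc)
qed simp

lemma schwartz_ident_mult:
  assumes "\<phi> \<in> schwartz"
  shows "(\<lambda>t. of_real t * \<phi> t) \<in> schwartz"
  unfolding schwartz_def mem_Collect_eq vderiv_funpow_ident_mult[OF assms]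
proof (intro conjI allI)
  fix k n
  have "(\<lambda>t. t ^ k *\<^sub>R (of_real t * (vderiv ^^ n) \<phi> t + of_nat n * (vderiv ^^ (n - 1)) \<phi> t)) =
        (\<lambda>t. 1 * (t ^ Suc k *\<^sub>R (vderiv ^^ n) \<phi> t) + of_nat n * (t ^ k *\<^sub>R (vderiv ^^ (n - 1)) \<phi> t))"
    by (simp add: algebra_simps scaleR_conv_of_real)
  then show "bounded (range (\<lambda>t. t ^ k *\<^sub>R (of_real t * (vderiv ^^ n) \<phi> t + of_nat n * (vderiv ^^ (n - 1)) \<phi> t)))"
    by (simp only: bounded_range_lincomb[OF schwartz_bounded[OF assms] schwartz_bounded[OF assms]])
next
  fix n t
  show "(\<lambda>t. of_real t * (vderiv ^^ n) \<phi> t + of_nat n * (vderiv ^^ (n - 1)) \<phi> t) differentiable at t"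
    using schwartz_differentiable[OF assms, of _ t]
      differentiableI_vector[OF has_vector_derivative_of_real[OF DERIV_ident]]
    by (intro differentiable_add differentiable_mult differentiable_const) auto
qed

section \<open>Decay and integrability of Schwartz functions\<close>

lemma integrable_inverse_1_plus_sq: "integrable lborel (\<lambda>x::real. inverse (1 + x^2))"
  using integrable_inverse_1_plus_square by (simp add: set_integrable_def)

text \<open>The bounds with weights 1 and t^2 add up to a bound with weight 1 + t^2. The majorant is
  integrable and tends to 0, which serves both integrability and the boundary terms of integration
  by parts.\<close>

lemma schwartz_decay:
  assumes "\<phi> \<in> schwartz"
  obtains C where "\<And>t. norm (\<phi> t) \<le> C * inverse (1 + t^2)"
proof -
  obtain A B where A: "\<And>t. norm (t ^ 0 *\<^sub>R (vderiv ^^ 0) \<phi> t) \<le> A"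
    and B: "\<And>t. norm (t ^ 2 *\<^sub>R (vderiv ^^ 0) \<phi> t) \<le> B"
    using schwartz_bounded[OF assms, of 0 0] schwartz_bounded[OF assms, of 2 0]
    by (auto simp: bounded_iff)
  have "norm (\<phi> t) \<le> (A + B) * inverse (1 + t^2)" for t
  proof -
    have "1 + t^2 > 0" by (simp add: add_pos_nonneg)
    then show ?thesis
      using A[of t] B[of t] by (simp add: field_simps)
  qed
  then show ?thesis using that by blast
qed

lemma schwartz_integrable:
  assumes "\<phi> \<in> schwartz"
  shows "integrable lborel \<phi>"
proof -
  obtain C where C: "\<And>t. norm (\<phi> t) \<le> C * inverse (1 + t^2)"
    using schwartz_decay[OF assms] by blast
  show ?thesis
  proof (rule Bochner_Integration.integrable_bound)
    show "integrable lborel (\<lambda>t::real. C * inverse (1 + t^2))"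
      by (intro integrable_mult_right integrable_inverse_1_plus_sq)
    show "AE t in lborel. norm (\<phi> t) \<le> norm (C * inverse (1 + t^2))"
      using C by (intro AE_I2) (metis abs_ge_self order_trans real_norm_def)
  qed (use assms in measurable)
qed

lemma integrable_bounded_mult_schwartz:
  assumes "\<phi> \<in> schwartz" and [measurable]: "h \<in> borel_measurable borel"
    and "\<And>t. norm (h t) \<le> C"
  shows "integrable lborel (\<lambda>t. h t * \<phi> t :: complex)"
proof (rule Bochner_Integration.integrable_bound)
  show "integrable lborel (\<lambda>t. C * norm (\<phi> t))"
    using schwartz_integrable[OF assms(1)] by (intro integrable_mult_right integrable_norm)
  have "0 \<le> C" using assms(3)[of 0] norm_ge_zero order_trans by blast
  then show "AE t in lborel. norm (h t * \<phi> t) \<le> norm (C * norm (\<phi> t))"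
    using assms(3) by (intro AE_I2) (auto simp: norm_mult intro: mult_right_mono)
qed (use assms(1) in measurable)

section \<open>The Fourier transform and differentiation\<close>

lemma fourier_iexp: "fourier \<phi> \<omega> = (LINT t|lborel. iexp (t * \<omega>) * \<phi> t)"
  by (simp add: fourier_def)

lemma fourier_integrable:
  assumes "\<phi> \<in> schwartz" shows "integrable lborel (\<lambda>t. iexp (t * \<omega>) * \<phi> t)"
  by (rule integrable_bounded_mult_schwartz[OF assms, where C=1]) auto

lemma fourier_bounded:
  assumes "\<phi> \<in> schwartz" shows "bounded (range (fourier \<phi>))"
proof -
  have "norm (fourier \<phi> \<omega>) \<le> (LINT t|lborel. norm (\<phi> t))" for \<omega>
    unfolding fourier_iexp
    by (rule order_trans[OF integral_norm_bound]) (simp add: norm_mult)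
  then show ?thesis by (auto simp: bounded_iff)
qed

lemma half_abs_power2_le: "\<bar>x\<bar> ^ Suc 1 / fact (Suc 1) \<le> \<bar>x\<bar>\<^sup>2" for x :: real
  by (simp add: power2_eq_square)

text \<open>Differentiation under the integral by an explicit estimate: after factoring out
  \<open>iexp (t * \<omega>)\<close>, the integrand is a second-order Taylor remainder of the
  exponential, so the error is at most (\<eta> - \<omega>)^2 times the L1 norm of t^2 \<phi>, which
  is what \<open>\<rho>\<close> and \<open>B\<close> stand for.\<close>

lemma fourier_has_vector_derivative:
  assumes \<phi>: "\<phi> \<in> schwartz"
  shows "(fourier \<phi> has_vector_derivative fourier (\<lambda>t. \<i> * (of_real t * \<phi> t)) \<omega>) (at \<omega>)"
proof -
  define \<psi> where "\<psi> = (\<lambda>t. \<i> * (of_real t * \<phi> t))"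
  define \<rho> where "\<rho> = (\<lambda>t. of_real t * (of_real t * \<phi> t))"
  have \<psi>: "\<psi> \<in> schwartz" and \<rho>: "\<rho> \<in> schwartz"
    unfolding \<psi>_def \<rho>_def using \<phi> by (auto intro: schwartz_cmult schwartz_ident_mult)
  define B where "B = (LINT t|lborel. norm (\<rho> t))"
  have B: "norm (fourier \<phi> \<eta> - fourier \<phi> \<omega> - (\<eta> - \<omega>) *\<^sub>R fourier \<psi> \<omega>) \<le> (\<eta> - \<omega>)^2 * B" for \<eta>
  proof -
    have "fourier \<phi> \<eta> - fourier \<phi> \<omega> - (\<eta> - \<omega>) *\<^sub>R fourier \<psi> \<omega> =
      (LINT t|lborel. iexp (t * \<eta>) * \<phi> t - iexp (t * \<omega>) * \<phi> t - (\<eta> - \<omega>) *\<^sub>R (iexp (t * \<omega>) * \<psi> t))"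
      unfolding fourier_iexp
      by (simp only: fourier_integrable \<phi> \<psi> Bochner_Integration.integral_diff
          Bochner_Integration.integrable_diff integral_scaleR_right integrable_scaleR_right simp_thms)
    also have "norm \<dots> \<le> (LINT t|lborel. (\<eta> - \<omega>)^2 * norm (\<rho> t))"
    proof (rule Bochner_Integration.integral_norm_bound_integral)
      fix t :: real
      have "norm (iexp (t * \<eta>) * \<phi> t - iexp (t * \<omega>) * \<phi> t - (\<eta> - \<omega>) *\<^sub>R (iexp (t * \<omega>) * \<psi> t)) =
        norm (iexp (t * \<omega>) * \<phi> t * (iexp (t * (\<eta> - \<omega>)) - (\<Sum>k\<le>1. (\<i> * (t * (\<eta> - \<omega>)))^k / fact k)))"
      proof -
        have "iexp (t * \<eta>) = iexp (t * \<omega>) * iexp (t * (\<eta> - \<omega>))"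
          by (simp add: mult_exp_exp algebra_simps)
        then show ?thesis
          by (simp add: \<psi>_def algebra_simps scaleR_conv_of_real)
      qed
      also have "\<dots> = norm (\<phi> t) * norm (iexp (t * (\<eta> - \<omega>)) - (\<Sum>k\<le>1. (\<i> * (t * (\<eta> - \<omega>)))^k / fact k))"
        by (simp add: norm_mult)
      also have "\<dots> \<le> norm (\<phi> t) * (\<bar>t * (\<eta> - \<omega>)\<bar>^2)"
      proof (rule mult_left_mono)
        have "norm (iexp (t * (\<eta> - \<omega>)) - (\<Sum>k\<le>1. (\<i> * (t * (\<eta> - \<omega>)))^k / fact k)) \<le>
          \<bar>t * (\<eta> - \<omega>)\<bar>^(Suc 1) / fact (Suc 1)"
          by (rule iexp_approx1)
        also have "\<dots> \<le> \<bar>t * (\<eta> - \<omega>)\<bar>^2"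
          by (rule half_abs_power2_le)
        finally show "norm (iexp (t * (\<eta> - \<omega>)) - (\<Sum>k\<le>1. (\<i> * (t * (\<eta> - \<omega>)))^k / fact k)) \<le> \<bar>t * (\<eta> - \<omega>)\<bar>^2" .
      qed simp
      also have "\<dots> = (\<eta> - \<omega>)^2 * norm (\<rho> t)"
        by (simp add: \<rho>_def norm_mult power_mult_distrib) (simp add: power2_eq_square flip: mult.assoc)
      finally show "norm (iexp (t * \<eta>) * \<phi> t - iexp (t * \<omega>) * \<phi> t - (\<eta> - \<omega>) *\<^sub>R (iexp (t * \<omega>) * \<psi> t))
        \<le> (\<eta> - \<omega>)^2 * norm (\<rho> t)" .
    next
      show "integrable lborel (\<lambda>t. (\<eta> - \<omega>)^2 * norm (\<rho> t))"
        using \<rho> by (intro integrable_mult_right integrable_norm schwartz_integrable)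
    qed (intro Bochner_Integration.integrable_diff integrable_scaleR_right fourier_integrable \<phi> \<psi>)
    finally show ?thesis by (simp add: B_def)
  qed
  have "((\<lambda>\<eta>. norm (fourier \<phi> \<eta> - fourier \<phi> \<omega> - (\<eta> - \<omega>) *\<^sub>R fourier \<psi> \<omega>) / norm (\<eta> - \<omega>)) \<longlongrightarrow> 0) (at \<omega>)"
  proof (rule real_tendsto_sandwich[where f="\<lambda>_. 0" and h="\<lambda>\<eta>. \<bar>\<eta> - \<omega>\<bar> * B"])
    show "\<forall>\<^sub>F \<eta> in at \<omega>. norm (fourier \<phi> \<eta> - fourier \<phi> \<omega> - (\<eta> - \<omega>) *\<^sub>R fourier \<psi> \<omega>) / norm (\<eta> - \<omega>) \<le> \<bar>\<eta> - \<omega>\<bar> * B"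
      unfolding eventually_at_filter
    proof (intro always_eventually allI impI)
      fix \<eta> assume "\<eta> \<noteq> \<omega>"
      then show "norm (fourier \<phi> \<eta> - fourier \<phi> \<omega> - (\<eta> - \<omega>) *\<^sub>R fourier \<psi> \<omega>) / norm (\<eta> - \<omega>) \<le> \<bar>\<eta> - \<omega>\<bar> * B"
        using B[of \<eta>] by (simp add: pos_divide_le_eq power2_eq_square mult_ac flip: power2_abs[of "\<eta> - \<omega>"])
    qed
    have "((\<lambda>\<eta>. \<bar>\<eta> - \<omega>\<bar> * B) \<longlongrightarrow> \<bar>\<omega> - \<omega>\<bar> * B) (at \<omega>)"
      by (intro tendsto_intros)
    then show "((\<lambda>\<eta>. \<bar>\<eta> - \<omega>\<bar> * B) \<longlongrightarrow> 0) (at \<omega>)" by simp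
  qed auto
  then show ?thesis
    unfolding has_vector_derivative_def \<psi>_def[symmetric]
    by (simp add: has_derivative_iff_norm bounded_linear_scaleR_left)
qed

lemma schwartz_tendsto_0:
  assumes \<phi>: "\<phi> \<in> schwartz"
  shows "((\<lambda>t. iexp (t * \<omega>) * \<phi> t) \<longlongrightarrow> 0) at_top" "((\<lambda>t. iexp (t * \<omega>) * \<phi> t) \<longlongrightarrow> 0) at_bot"
proof -
  obtain C where C: "\<And>t. norm (\<phi> t) \<le> C * inverse (1 + t^2)"
    using schwartz_decay[OF \<phi>] by blast
  have *: "((\<lambda>t. C * inverse (1 + t^2)) \<longlongrightarrow> 0) at_top" "((\<lambda>t. C * inverse (1 + t^2)) \<longlongrightarrow> 0) at_bot"
    by real_asymp+
  show "((\<lambda>t. iexp (t * \<omega>) * \<phi> t) \<longlongrightarrow> 0) at_top" "((\<lambda>t. iexp (t * \<omega>) * \<phi> t) \<longlongrightarrow> 0) at_bot"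
    by (rule Lim_null_comparison[OF _ *(1)] Lim_null_comparison[OF _ *(2)], simp add: norm_mult C)+
qed

text \<open>Integration by parts on the whole line, in the form that the derivative of
  \<open>iexp (t * \<omega>) * \<phi> t\<close> integrates to the difference of its limits at
  infinity, both 0. The minus sign reflects the convention exp(+i t \<omega>).\<close>

lemma fourier_vderiv:
  assumes \<phi>: "\<phi> \<in> schwartz"
  shows "fourier (vderiv \<phi>) \<omega> = - \<i> * of_real \<omega> * fourier \<phi> \<omega>"
proof -
  let ?F = "\<lambda>t. iexp (t * \<omega>) * \<phi> t"
  let ?f = "\<lambda>t. \<i> * of_real \<omega> * (iexp (t * \<omega>) * \<phi> t) + iexp (t * \<omega>) * vderiv \<phi> t"
  note [simp] = schwartz_vderiv[OF \<phi>] \<phi>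
  have "(LBINT t=-\<infinity>..\<infinity>. ?f t) = 0 - 0"
  proof (rule interval_integral_FTC_integrable[where F="?F"])
    fix t :: real
    have "((\<lambda>t. iexp (t * \<omega>)) has_vector_derivative \<omega> *\<^sub>R (\<i> * iexp (t * \<omega>))) (at t)"
    proof (rule vector_diff_chain_at[of "\<lambda>t. t * \<omega>" _ t iexp, unfolded o_def])
      show "((\<lambda>t. t * \<omega>) has_vector_derivative \<omega>) (at t)"
        by (auto intro!: derivative_eq_intros)
      show "(iexp has_vector_derivative \<i> * iexp (t * \<omega>)) (at (t * \<omega>))"
        by (rule has_vector_derivative_iexp)
    qed
    from has_vector_derivative_mult[OF this schwartz_has_vderiv[OF \<phi>]]
    show "(?F has_vector_derivative ?f t) (at t)"
      by (simp add: algebra_simps scaleR_conv_of_real)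
    show "isCont ?f t"
      by (intro continuous_intros schwartz_continuous) auto
  next
    show "set_integrable lborel (einterval (-\<infinity>) \<infinity>) ?f"
      unfolding set_integrable_def
      by (simp del: of_real_mult) (intro Bochner_Integration.integrable_add integrable_mult_right fourier_integrable; simp)
  qed (auto simp: ereal_tendsto_simps schwartz_tendsto_0 simp del: of_real_mult)
  then have "(LINT t|lborel. ?f t) = 0"
    by (simp add: interval_lebesgue_integral_def set_lebesgue_integral_def)
  moreover have "(LINT t|lborel. ?f t) = \<i> * of_real \<omega> * fourier \<phi> \<omega> + fourier (vderiv \<phi>) \<omega>"
    unfolding fourier_iexp
    by (simp only: fourier_integrable schwartz_vderiv \<phi> Bochner_Integration.integral_add integrable_mult_right integral_mult_right_zero)
  ultimately show ?thesis by (simp add: add_eq_0_iff2)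
qed

lemma fourier_cmult: "fourier (\<lambda>t. a * \<phi> t) \<omega> = a * fourier \<phi> \<omega>"
proof -
  have "iexp (t * \<omega>) * (a * \<phi> t) = a * (iexp (t * \<omega>) * \<phi> t)" for t by simp
  then show ?thesis unfolding fourier_iexp by (simp only: integral_mult_right_zero)
qed

text \<open>
  Needed because functionals are \<open>undefined\<close> off \<open>schwartz\<close>. The set of Fourier transforms of
  Schwartz functions consists of bounded functions and is closed under differentiation and
  multiplication by the variable.
\<close>

proposition fourier_schwartz:
  assumes \<phi>: "\<phi> \<in> schwartz"
  shows "fourier \<phi> \<in> schwartz"
proof -
  have vd: "vderiv (fourier \<psi>) = fourier (\<lambda>t. \<i> * (of_real t * \<psi> t))" if "\<psi> \<in> schwartz" for \<psi>
    using fourier_has_vector_derivative[OF that] by (auto intro!: vderiv_eqI)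
  have 1: "\<exists>\<psi>\<in>schwartz. (vderiv ^^ n) (fourier \<phi>) = fourier \<psi>" for n
  proof (induction n)
    case (Suc n)
    then obtain \<psi> where \<psi>: "\<psi> \<in> schwartz" and eq: "(vderiv ^^ n) (fourier \<phi>) = fourier \<psi>" by blast
    have "(vderiv ^^ Suc n) (fourier \<phi>) = fourier (\<lambda>t. \<i> * (of_real t * \<psi> t))"
      using vd[OF \<psi>] by (simp add: eq)
    then show ?case using schwartz_cmult[OF schwartz_ident_mult[OF \<psi>]] by blast
  qed (use \<phi> in auto)
  have 2: "\<exists>\<rho>\<in>schwartz. (\<lambda>\<omega>. \<omega> ^ k *\<^sub>R fourier \<psi> \<omega>) = fourier \<rho>" if \<psi>: "\<psi> \<in> schwartz" for \<psi> k
  proof (induction k)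
    case (Suc k)
    then obtain \<rho> where \<rho>: "\<rho> \<in> schwartz" and eq: "(\<lambda>\<omega>. \<omega> ^ k *\<^sub>R fourier \<psi> \<omega>) = fourier \<rho>" by blast
    have "\<omega> ^ Suc k *\<^sub>R fourier \<psi> \<omega> = fourier (\<lambda>t. \<i> * vderiv \<rho> t) \<omega>" for \<omega>
      using fun_cong[OF eq, of \<omega>] by (simp add: fourier_cmult fourier_vderiv[OF \<rho>] scaleR_conv_of_real mult_ac)
    then show ?case using schwartz_cmult[OF schwartz_vderiv[OF \<rho>]] by blast
  qed (use \<psi> in auto)
  show ?thesis
    unfolding schwartz_def mem_Collect_eq
  proof (intro conjI allI)
    fix n t
    obtain \<psi> where \<psi>: "\<psi> \<in> schwartz" and "(vderiv ^^ n) (fourier \<phi>) = fourier \<psi>" using 1 by blast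
    then show "(vderiv ^^ n) (fourier \<phi>) differentiable at t"
      using fourier_has_vector_derivative[OF \<psi>] by (auto intro: differentiableI_vector)
  next
    fix k n
    obtain \<psi> where "\<psi> \<in> schwartz" "(vderiv ^^ n) (fourier \<phi>) = fourier \<psi>" using 1 by blast
    moreover obtain \<rho> where "\<rho> \<in> schwartz" "(\<lambda>\<omega>. \<omega> ^ k *\<^sub>R fourier \<psi> \<omega>) = fourier \<rho>"
      using 2 calculation(1) by blast
    ultimately show "bounded (range (\<lambda>t. t ^ k *\<^sub>R (vderiv ^^ n) (fourier \<phi>) t))"
      using fourier_bounded by metis
  qed
qed

section \<open>Indicator functions as elements of the operator domain\<close>

lemma norm_le_schwartz_seminorm:
  assumes "\<phi> \<in> schwartz" shows "norm (\<phi> t) \<le> schwartz_seminorm 0 0 \<phi>"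
proof -
  have "bounded (range \<phi>)" using schwartz_bounded[OF assms, of 0 0] by simp
  then have "bdd_above (range (\<lambda>t. norm (\<phi> t)))" by (auto simp: bounded_iff bdd_above_def)
  then show ?thesis by (auto simp: schwartz_seminorm_def intro: cSUP_upper)
qed

lemma integrable_indicator_mult_schwartz:
  "\<phi> \<in> schwartz \<Longrightarrow> integrable lborel (\<lambda>u. indicator {0..t::real} u * \<phi> u)"
  by (rule integrable_bounded_mult_schwartz[where C=1]) (auto simp: indicator_def)

text \<open>The pairing is at most the length t times the supremum of
  \<open>norm (\<phi> u)\<close>, which is the seminorm with indices 0 and 0; hence the witnesses C
  = t and N = 0.\<close>

lemma indicator_tempered_distribution:
  assumes "0 \<le> t"
  shows "distribution_of (indicator {0..t}) \<in> tempered_distributions"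
  unfolding tempered_distributions_def
proof (intro CollectI conjI ballI allI)
  let ?I = "indicator {0..t} :: real \<Rightarrow> complex"
  show "distribution_of ?I \<in> extensional schwartz"
    by (simp add: distribution_of_def)
  fix \<phi> \<psi> and a b :: complex assume *: "\<phi> \<in> schwartz" "\<psi> \<in> schwartz"
  have "(LINT u|lborel. ?I u * (a * \<phi> u + b * \<psi> u)) =
      (LINT u|lborel. a * (?I u * \<phi> u) + b * (?I u * \<psi> u))"
    by (intro Bochner_Integration.integral_cong) (auto simp: algebra_simps)
  also have "\<dots> = a * (LINT u|lborel. ?I u * \<phi> u) + b * (LINT u|lborel. ?I u * \<psi> u)"
    using * by (simp only: Bochner_Integration.integral_add integrable_mult_right
        integrable_indicator_mult_schwartz integral_mult_right_zero)
  finally show "distribution_of ?I (\<lambda>u. a * \<phi> u + b * \<psi> u) = a * distribution_of ?I \<phi> + b * distribution_of ?I \<psi>"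
    using * by (simp add: distribution_of_def schwartz_lincomb)
next
  let ?I = "indicator {0..t} :: real \<Rightarrow> complex"
  show "\<exists>C N. \<forall>\<phi>\<in>schwartz. norm (distribution_of ?I \<phi>) \<le> C * (\<Sum>k\<le>N. \<Sum>n\<le>N. schwartz_seminorm k n \<phi>)"
  proof (intro exI ballI)
    fix \<phi> assume \<phi>: "\<phi> \<in> schwartz"
    have "norm (LINT u|lborel. ?I u * \<phi> u) \<le> (LINT u|lborel. schwartz_seminorm 0 0 \<phi> * indicator {0..t} u)"
    proof (rule Bochner_Integration.integral_norm_bound_integral)
      show "integrable lborel (\<lambda>u. schwartz_seminorm 0 0 \<phi> * indicator {0..t} u)"
        by (intro integrable_mult_right integrable_real_indicator) (auto simp: emeasure_lborel_Icc_eq)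
    qed (use norm_le_schwartz_seminorm[OF \<phi>] integrable_indicator_mult_schwartz[OF \<phi>] in
          \<open>auto simp: indicator_def\<close>)
    also have "\<dots> = t * schwartz_seminorm 0 0 \<phi>"
      using assms by simp
    finally show "norm (distribution_of ?I \<phi>) \<le> t * (\<Sum>k\<le>0. \<Sum>n\<le>0. schwartz_seminorm k n \<phi>)"
      using \<phi> by (simp add: distribution_of_def)
  qed
qed

section \<open>The Fourier transform of an indicator function\<close>

lemma fourier_indicator:
  assumes "0 \<le> t" "\<omega> \<noteq> 0"
  shows "fourier (indicator {0..t}) \<omega> = (iexp (t * \<omega>) - 1) / (\<i> * of_real \<omega>)"
proof -
  have "fourier (indicator {0..t}) \<omega> = (LINT u|lborel. indicator {0..t} u *\<^sub>R iexp (u * \<omega>))"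
    unfolding fourier_def by (intro Bochner_Integration.integral_cong) (auto simp: indicator_def)
  also have "\<dots> = iexp (t * \<omega>) / (\<i> * of_real \<omega>) - iexp (0 * \<omega>) / (\<i> * of_real \<omega>)"
  proof (rule integral_FTC_atLeastAtMost)
    fix u :: real
    have "((\<lambda>u. iexp (u * \<omega>)) has_vector_derivative \<omega> *\<^sub>R (\<i> * iexp (u * \<omega>))) (at u)"
    proof (rule vector_diff_chain_at[of "\<lambda>t. t * \<omega>" _ u iexp, unfolded o_def])
      show "((\<lambda>t. t * \<omega>) has_vector_derivative \<omega>) (at u)"
        by (auto intro!: derivative_eq_intros)
    qed (rule has_vector_derivative_iexp)
    from has_vector_derivative_divide[OF this, of "\<i> * of_real \<omega>"]
    show "((\<lambda>u. iexp (u * \<omega>) / (\<i> * of_real \<omega>)) has_vector_derivative iexp (u * \<omega>)) (at u within {0..t})"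
      using assms by (simp add: scaleR_conv_of_real has_vector_derivative_at_within)
  qed (use assms in \<open>auto intro!: continuous_intros\<close>)
  finally show ?thesis by (simp add: diff_divide_distrib)
qed

text \<open>This is where the Fejer-type kernel arises, from |exp(i x) - 1|^2 = 2 (1 - cos x). At
  \<omega> = 0 the right-hand side is 0 by the convention for division, while the left-hand side is
  t^2; the formula is therefore used almost everywhere.\<close>

lemma norm_fourier_indicator:
  assumes "0 \<le> t" "\<omega> \<noteq> 0"
  shows "(norm (fourier (indicator {0..t}) \<omega>))\<^sup>2 = 2 * (1 - cos (t * \<omega>)) / \<omega>\<^sup>2"
proof -
  have "(norm (iexp (t * \<omega>) - 1))\<^sup>2 = (cos (t * \<omega>) - 1)\<^sup>2 + (sin (t * \<omega>))\<^sup>2"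
    unfolding cmod_power2 by (simp add: Re_exp Im_exp)
  also have "\<dots> = 2 * (1 - cos (t * \<omega>))"
    using sin_cos_squared_add[of "t * \<omega>"] by (simp add: power2_diff)
  finally show ?thesis
    unfolding fourier_indicator[OF assms] by (simp add: norm_divide norm_mult power_divide del: of_real_mult)
qed

lemma fourier_indicator_measurable [measurable]:
  "fourier (indicator {0..t}) \<in> borel_measurable borel"
  unfolding fourier_def by measurable

lemma fourier_indicator_bounded:
  assumes "0 \<le> t" shows "norm (fourier (indicator {0..t}) \<omega>) \<le> t"
proof -
  have "norm (fourier (indicator {0..t}) \<omega>) \<le> (LINT u|lborel. norm (exp (\<i> * complex_of_real (u * \<omega>)) * indicator {0..t} u))"
    unfolding fourier_def by (rule integral_norm_bound)
  also have "\<dots> = (LINT u|lborel. indicator {0..t} u)"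
    by (intro Bochner_Integration.integral_cong) (auto simp: norm_mult indicator_def simp del: of_real_mult)
  finally show ?thesis using assms by simp
qed

text \<open>The kernel exp(i s u) is symmetric, so Fubini's theorem moves the transform from the
  test function to the indicator. Off \<open>schwartz\<close> both functionals are
  \<open>undefined\<close>, which settles the remaining arguments of the equality.\<close>

lemma fourier_distribution_indicator:
  assumes "0 \<le> t"
  shows "is_function (fourier_distribution (distribution_of (indicator {0..t}))) (fourier (indicator {0..t}))"
  unfolding is_function_def
proof (intro conjI ballI ext)
  let ?I = "indicator {0..t} :: real \<Rightarrow> complex"
  show "fourier ?I \<in> borel_measurable borel" by measurable
  show "integrable lborel (\<lambda>s. fourier ?I s * \<phi> s)" if "\<phi> \<in> schwartz" for \<phi>
    using that by (rule integrable_bounded_mult_schwartz) (auto intro: fourier_indicator_bounded[OF assms])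
  fix \<phi>
  show "fourier_distribution (distribution_of ?I) \<phi> = distribution_of (fourier ?I) \<phi>"
  proof (cases "\<phi> \<in> schwartz")
    case \<phi>: True
    define f where "f = (\<lambda>u s. ?I u * (iexp (s * u) * \<phi> s))"
    have "integrable (lborel \<Otimes>\<^sub>M lborel) (\<lambda>(u, s). f u s)"
    proof (rule Bochner_Integration.integrable_bound)
      \<comment> \<open>The exponential has modulus 1, so this product of functions in separate
        variables has the same norm as \<open>f\<close> and serves as majorant.\<close>
      have "integrable (lborel \<Otimes>\<^sub>M lborel) (\<lambda>(u, s). ?I u * \<phi> s)"
      proof (rule lborel_pair.Fubini_integrable)
        show "(\<lambda>(u, s). ?I u * \<phi> s) \<in> borel_measurable (lborel \<Otimes>\<^sub>M lborel)"
          using \<phi> by measurable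
        show "integrable lborel (\<lambda>u. LINT s|lborel. norm (case (u, s) of (u, s) \<Rightarrow> ?I u * \<phi> s))"
        proof -
          have "(LINT s|lborel. norm (?I u * \<phi> s)) = indicator {0..t} u * (LINT s|lborel. norm (\<phi> s))" for u
            by (simp add: norm_mult indicator_def)
          then show ?thesis by (simp add: emeasure_lborel_Icc_eq)
        qed
        show "AE u in lborel. integrable lborel (\<lambda>s. case (u, s) of (u, s) \<Rightarrow> ?I u * \<phi> s)"
          using schwartz_integrable[OF \<phi>] by auto
      qed
      then show "integrable (lborel \<Otimes>\<^sub>M lborel) (\<lambda>(u, s). ?I u * \<phi> s)" .
      show "(\<lambda>(u, s). f u s) \<in> borel_measurable (lborel \<Otimes>\<^sub>M lborel)"
        using \<phi> unfolding f_def by measurable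
    qed (auto simp: f_def norm_mult simp del: of_real_mult)
    from lborel_pair.Fubini_integral[OF this]
    have "(LINT u|lborel. LINT s|lborel. f u s) = (LINT s|lborel. LINT u|lborel. f u s)" by simp
    moreover have "(LINT s|lborel. f u s) = ?I u * fourier \<phi> u" for u
      unfolding f_def fourier_iexp by (simp only: integral_mult_right_zero)
    moreover have "(LINT u|lborel. f u s) = fourier ?I s * \<phi> s" for s
    proof -
      have "(LINT u|lborel. f u s) = (LINT u|lborel. (iexp (u * s) * ?I u) * \<phi> s)"
        unfolding f_def by (intro Bochner_Integration.integral_cong) (auto simp: mult_ac)
      then show ?thesis unfolding fourier_iexp by (simp only: integral_mult_left_zero)
    qed
    ultimately show ?thesis
      using \<phi> by (simp add: fourier_distribution_def distribution_of_def fourier_schwartz)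
  qed (simp add: fourier_distribution_def distribution_of_def)
qed

section \<open>A Tauberian estimate for integrals against the Fejer kernel\<close>

text \<open>Half-angle formula. This bound controls the kernel near the origin, the constant bound
  \<open>one_minus_cos_le_4\<close> controls it at infinity.\<close>

lemma one_minus_cos_le: "2 * (1 - cos x) \<le> x\<^sup>2" for x :: real
proof -
  have "(sin (x / 2))\<^sup>2 \<le> (x / 2)\<^sup>2"
    using abs_sin_x_le_abs_x abs_le_square_iff by blast
  moreover have "cos x = 1 - 2 * (sin (x / 2))\<^sup>2"
    using cos_double_sin[of "x / 2"] by simp
  ultimately show ?thesis by (simp add: power_divide)
qed

lemma one_minus_cos_le_4: "2 * (1 - cos x) \<le> 4" for x :: real
proof -
  have "2 * (1 - c) \<le> 4" if "-1 \<le> c" for c :: real using that by simp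
  from this[OF cos_ge_minus_one] show ?thesis .
qed

section \<open>Integrability and positivity of the kernel\<close>

lemma integrable_powr_tail:
  assumes "e < -1"
  shows "integrable lborel (\<lambda>x::real. indicator {1..} x * x powr e)"
proof -
  have "((\<lambda>x::real. x powr e) has_integral -(1 powr (e + 1)) / (e + 1)) {1..}"
    by (rule has_integral_powr_to_inf) (use assms in auto)
  then have "(\<lambda>x::real. x powr e) absolutely_integrable_on {1..}"
    by (intro nonnegative_absolutely_integrable_1) auto
  then have "integrable lebesgue (\<lambda>x::real. indicator {1..} x * x powr e)"
    by (simp add: set_integrable_def)
  then show ?thesis
    by (subst (asm) integrable_completion) auto
qed

lemma integrable_powr_tail_abs:
  assumes "e < -1"
  shows "integrable lborel (\<lambda>x::real. indicator {x. 1 < \<bar>x\<bar>} x * \<bar>x\<bar> powr e)"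
proof -
  let ?f = "\<lambda>x::real. indicator {1..} x * x powr e"
  have "integrable lborel (\<lambda>x. ?f x + ?f (- x))"
    using integrable_powr_tail[OF assms] lborel_integrable_real_affine[of ?f "-1" 0]
    by (intro Bochner_Integration.integrable_add) auto
  then show ?thesis
    by (rule Bochner_Integration.integrable_bound) (auto simp: indicator_def)
qed

text \<open>\<open>ln u \<le> u - 1\<close> at the square root of y. Trading the logarithm for the
  power 1/2 turns the kernel's decay |x|^(-2) into |x|^(-3/2), which is still integrable.\<close>

lemma one_plus_ln_le: "1 + ln y \<le> 2 * y powr (1/2)" if "y > 0" for y :: real
proof -
  have "ln (y powr (1/2)) \<le> y powr (1/2) - 1"
    using that by (intro ln_le_minus_one) auto
  then show ?thesis using that by (simp add: ln_powr)
qed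

text \<open>Up to a constant this is the dominating function for the rescaled spectral integral; the
  weight bounds the ratio of ln t to ln (t / |x|) when the latter is at least 1. The positive part
  is taken because ln |x| is unbounded below near 0.\<close>

lemma integrable_fejer_log:
  "integrable lborel (\<lambda>x::real. 2 * (1 - cos x) / x\<^sup>2 * (1 + max 0 (ln \<bar>x\<bar>)))"
proof (rule Bochner_Integration.integrable_bound)
  show "integrable lborel (\<lambda>x::real. indicator {-1..1} x + 8 * (indicator {x. 1 < \<bar>x\<bar>} x * \<bar>x\<bar> powr (-3/2)))"
    by (intro Bochner_Integration.integrable_add integrable_mult_right integrable_powr_tail_abs
        integrable_real_indicator) auto
  show "AE x::real in lborel. norm (2 * (1 - cos x) / x\<^sup>2 * (1 + max 0 (ln \<bar>x\<bar>)))
    \<le> norm (indicator {-1..1} x + 8 * (indicator {x. 1 < \<bar>x\<bar>} x * \<bar>x\<bar> powr (-3/2)))"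
  proof (rule AE_I2)
    fix x :: real
    have nn: "0 \<le> 2 * (1 - cos x) / x\<^sup>2" by simp
    show "norm (2 * (1 - cos x) / x\<^sup>2 * (1 + max 0 (ln \<bar>x\<bar>)))
      \<le> norm (indicator {-1..1} x + 8 * (indicator {x. 1 < \<bar>x\<bar>} x * \<bar>x\<bar> powr (-3/2)))"
    proof (cases "\<bar>x\<bar> \<le> 1")
      case True
      have "2 * (1 - cos x) / x\<^sup>2 \<le> 1"
        using one_minus_cos_le[of x] by (simp add: divide_le_eq)
      moreover have "max 0 (ln \<bar>x\<bar>) = 0"
        using True by (cases "x = 0") (auto simp: max_def)
      moreover have "x \<in> {-1..1}" using True by auto
      ultimately show ?thesis using True nn by simp
    next
      case False
      have "2 * (1 - cos x) / x\<^sup>2 * (1 + max 0 (ln \<bar>x\<bar>)) \<le> 4 / x\<^sup>2 * (2 * \<bar>x\<bar> powr (1/2))"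
      proof (rule mult_mono)
        show "2 * (1 - cos x) / x\<^sup>2 \<le> 4 / x\<^sup>2"
          by (intro divide_right_mono one_minus_cos_le_4) auto
        show "1 + max 0 (ln \<bar>x\<bar>) \<le> 2 * \<bar>x\<bar> powr (1/2)"
          using one_plus_ln_le[of "\<bar>x\<bar>"] False by (auto simp: max_def)
      qed (use False in auto)
      also have "4 / x\<^sup>2 * (2 * \<bar>x\<bar> powr (1/2)) = 8 * \<bar>x\<bar> powr (-3/2)"
      proof -
        have "x\<^sup>2 = \<bar>x\<bar> powr 2" using False by (subst powr_numeral) auto
        then show ?thesis using powr_diff[of "\<bar>x\<bar>" "1/2" 2] by simp
      qed
      finally have "2 * (1 - cos x) / x\<^sup>2 * (1 + max 0 (ln \<bar>x\<bar>)) \<le> 8 * \<bar>x\<bar> powr (-3/2)" .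
      moreover have "0 \<le> 2 * (1 - cos x) / x\<^sup>2 * (1 + max 0 (ln \<bar>x\<bar>))"
        using nn by (rule mult_nonneg_nonneg) simp
      moreover have "x \<notin> {-1..1}" using False by auto
      ultimately show ?thesis using False by simp
    qed
  qed
qed measurable

text \<open>Positivity suffices, since the relation \<open>\<asymp>\<^sub>c\<close> leaves the
  constant open. On [1, 2] cosine is at most cos 1 and x^2 is at most 4, which gives the lower bound
  (1 - cos 1) / 2 on an interval of length 1.\<close>

lemma integral_fejer_pos:
  assumes "integrable lborel (\<lambda>x::real. 2 * (1 - cos x) / x\<^sup>2)"
  shows "(LINT x|lborel. 2 * (1 - cos x) / x\<^sup>2) > (0::real)"
proof -
  let ?c = "(1 - cos 1) / 2 :: real"
  have "cos 1 < cos (0::real)"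
    using pi_gt3 by (intro cos_monotone_0_pi) auto
  then have "0 < ?c" by simp
  also have "?c = (LINT x::real|lborel. ?c * indicator {1..2} x)" by simp
  also have "\<dots> \<le> (LINT x::real|lborel. 2 * (1 - cos x) / x\<^sup>2)"
  proof (rule integral_mono[OF _ assms])
    fix x :: real
    show "?c * indicator {1..2} x \<le> 2 * (1 - cos x) / x\<^sup>2"
    proof (cases "x \<in> {1..2}")
      case True
      have "cos x \<le> cos 1"
        using True pi_gt3 by (intro cos_monotone_0_pi_le) auto
      have "?c = 2 * (1 - cos 1) / 2\<^sup>2" by simp
      also have "\<dots> \<le> 2 * (1 - cos x) / x\<^sup>2"
        using True \<open>cos x \<le> cos 1\<close> by (intro frac_le power_mono) auto
      finally show ?thesis using True by simp
    qed simp
  qed simp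
  finally show ?thesis .
qed

text \<open>Near 0 the limit hypothesis controls r, on bounded ranges \<open>loc\<close> does, and
  at infinity \<open>bdd\<close> does. The limiting constant is L times the integral of the
  kernel.\<close>

proposition spectral_integral_asymp:
  fixes r :: "real \<Rightarrow> real"
  assumes r [measurable]: "r \<in> borel_measurable borel" and nonneg: "\<And>\<omega>. 0 \<le> r \<omega>"
    and loc: "\<And>R. integrable lborel (\<lambda>\<omega>. indicator {-R..R} \<omega> * r \<omega>)"
    and bdd: "\<And>\<omega>. R \<le> \<bar>\<omega>\<bar> \<Longrightarrow> r \<omega> \<le> B"
    and lim: "((\<lambda>\<omega>. r \<omega> * ln (1 / \<bar>\<omega>\<bar>)) \<longlongrightarrow> L) (at 0)" and L: "L > 0"
  shows "integrable lborel (\<lambda>\<omega>. 2 * (1 - cos (t * \<omega>)) / \<omega>\<^sup>2 * r \<omega>)"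
    and "(\<lambda>t. LINT \<omega>|lborel. 2 * (1 - cos (t * \<omega>)) / \<omega>\<^sup>2 * r \<omega>) \<asymp>\<^sub>c (\<lambda>t. t / ln t)"
proof -
  have "\<forall>\<^sub>F \<omega> in at 0. r \<omega> * ln (1 / \<bar>\<omega>\<bar>) < 2 * L"
    using lim L by (intro order_tendstoD) auto
  then obtain d where d: "d > 0" "\<And>\<omega>. \<omega> \<noteq> 0 \<Longrightarrow> \<bar>\<omega>\<bar> < d \<Longrightarrow> r \<omega> * ln (1 / \<bar>\<omega>\<bar>) < 2 * L"
    by (auto simp: eventually_at dist_real_def)
  \<comment> \<open>The cap \<open>exp (-1)\<close> makes ln (1 / |\<omega>|) at least 1 on the
    neighbourhood, which the majorant below relies on.\<close>
  define \<delta> where "\<delta> = min d (exp (-1))"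
  have \<delta>: "\<delta> > 0" "\<delta> \<le> exp (-1)" and r\<delta>: "\<And>\<omega>. \<omega> \<noteq> 0 \<Longrightarrow> \<bar>\<omega>\<bar> < \<delta> \<Longrightarrow> r \<omega> * ln (1 / \<bar>\<omega>\<bar>) < 2 * L"
    using d by (auto simp: \<delta>_def)
  let ?f = "\<lambda>t \<omega>. 2 * (1 - cos (t * \<omega>)) / \<omega>\<^sup>2 * r \<omega>"
  let ?N = "{\<omega>. \<bar>\<omega>\<bar> < \<delta>}"
  \<comment> \<open>A majorant away from 0 that does not depend on t; its integral bounds
    \<open>I2\<close>.\<close>
  define q where "q = (\<lambda>\<omega>. indicator (- ?N) \<omega> * (4 / \<omega>\<^sup>2 * r \<omega>))"
  \<comment> \<open>Beyond 1 one has 1 + \<omega>^2 \<le> 2 \<omega>^2, so 4 / \<omega>^2 is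
    dominated by 8 / (1 + \<omega>^2).\<close>
  define R' where "R' = max 1 R"
  have B: "0 \<le> B" using bdd[of R'] bdd[of "\<bar>R\<bar>"] nonneg order_trans by (metis abs_ge_self abs_idempotent)
  have fnn: "0 \<le> ?f t \<omega>" for t \<omega> by (simp add: nonneg)
  have q: "integrable lborel q"
  proof (rule Bochner_Integration.integrable_bound)
    show "integrable lborel (\<lambda>\<omega>. 4 / \<delta>\<^sup>2 * (indicator {-R'..R'} \<omega> * r \<omega>) + 8 * B * inverse (1 + \<omega>\<^sup>2))"
      by (intro Bochner_Integration.integrable_add integrable_mult_right loc integrable_inverse_1_plus_sq)
    show "AE \<omega> in lborel. norm (q \<omega>) \<le> norm (4 / \<delta>\<^sup>2 * (indicator {-R'..R'} \<omega> * r \<omega>) + 8 * B * inverse (1 + \<omega>\<^sup>2))"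
    proof (rule AE_I2)
      fix \<omega> :: real
      have p: "0 \<le> 8 * B * inverse (1 + \<omega>\<^sup>2)" "0 \<le> 4 / \<delta>\<^sup>2 * (indicator {-R'..R'} \<omega> * r \<omega>)"
        using B nonneg by auto
      have "q \<omega> \<le> 4 / \<delta>\<^sup>2 * (indicator {-R'..R'} \<omega> * r \<omega>) + 8 * B * inverse (1 + \<omega>\<^sup>2)"
      proof (cases "\<omega> \<in> ?N")
        case True
        then show ?thesis using p by (simp add: q_def)
      next
        case N: False
        then have "\<omega> \<noteq> 0" using \<delta> by auto
        show ?thesis
        proof (cases "\<bar>\<omega>\<bar> \<le> R'")
          case True
          have "\<delta>\<^sup>2 \<le> \<omega>\<^sup>2" using N \<delta> by (intro abs_le_square_iff[THEN iffD1]) auto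
          then have "4 / \<omega>\<^sup>2 * r \<omega> \<le> 4 / \<delta>\<^sup>2 * r \<omega>"
            using \<delta> by (intro mult_right_mono nonneg frac_le) auto
          moreover have "\<omega> \<in> {-R'..R'}" using True by auto
          ultimately show ?thesis using p(1) N by (simp add: q_def)
        next
          case False
          then have "1 \<le> \<bar>\<omega>\<bar>" "R \<le> \<bar>\<omega>\<bar>" by (auto simp: R'_def)
          then have "1 + \<omega>\<^sup>2 \<le> 2 * \<omega>\<^sup>2" using abs_le_square_iff[of 1 \<omega>] by simp
          then have "4 / \<omega>\<^sup>2 \<le> 8 * inverse (1 + \<omega>\<^sup>2)"
            using \<open>\<omega> \<noteq> 0\<close> by (simp add: field_simps add_pos_nonneg)
          then have "4 / \<omega>\<^sup>2 * r \<omega> \<le> 8 * inverse (1 + \<omega>\<^sup>2) * B"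
            using bdd[OF \<open>R \<le> \<bar>\<omega>\<bar>\<close>] nonneg by (intro mult_mono) (auto simp: add_nonneg_nonneg)
          then show ?thesis using p(2) N by (simp add: q_def mult_ac)
        qed
      qed
      moreover have "0 \<le> q \<omega>" by (simp add: q_def nonneg)
      ultimately show "norm (q \<omega>) \<le> norm (4 / \<delta>\<^sup>2 * (indicator {-R'..R'} \<omega> * r \<omega>) + 8 * B * inverse (1 + \<omega>\<^sup>2))"
        by simp
    qed
  qed (simp add: q_def)
  have fq: "indicator (- ?N) \<omega> * ?f t \<omega> \<le> q \<omega>" for t \<omega>
    unfolding q_def
    by (intro mult_left_mono mult_right_mono divide_right_mono nonneg one_minus_cos_le_4) auto
  have int2: "integrable lborel (\<lambda>\<omega>. indicator (- ?N) \<omega> * ?f t \<omega>)" for t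
    by (rule Bochner_Integration.integrable_bound[OF q])
      (use fq nonneg in \<open>auto intro!: AE_I2 simp: abs_mult q_def indicator_def intro: order_trans\<close>)
  have int1: "integrable lborel (\<lambda>\<omega>. indicator ?N \<omega> * ?f t \<omega>)" for t
  proof (rule Bochner_Integration.integrable_bound)
    show "integrable lborel (\<lambda>\<omega>. t\<^sup>2 * (indicator {-\<delta>..\<delta>} \<omega> * r \<omega>))"
      by (intro integrable_mult_right loc)
    show "AE \<omega> in lborel. norm (indicator ?N \<omega> * ?f t \<omega>) \<le> norm (t\<^sup>2 * (indicator {-\<delta>..\<delta>} \<omega> * r \<omega>))"
    proof (rule AE_I2)
      fix \<omega> :: real
      have "2 * (1 - cos (t * \<omega>)) / \<omega>\<^sup>2 \<le> t\<^sup>2"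
        using one_minus_cos_le[of "t * \<omega>"] by (cases "\<omega> = 0") (simp_all add: field_simps)
      then have "?f t \<omega> \<le> t\<^sup>2 * r \<omega>" by (intro mult_right_mono nonneg)
      then have "indicator ?N \<omega> * ?f t \<omega> \<le> t\<^sup>2 * (indicator {-\<delta>..\<delta>} \<omega> * r \<omega>)"
        using nonneg by (auto simp: indicator_def)
      moreover have "0 \<le> indicator ?N \<omega> * ?f t \<omega>"
        by (intro mult_nonneg_nonneg fnn) simp
      ultimately show "norm (indicator ?N \<omega> * ?f t \<omega>) \<le> norm (t\<^sup>2 * (indicator {-\<delta>..\<delta>} \<omega> * r \<omega>))"
        unfolding real_norm_def by linarith
    qed
  qed measurable
  have split: "?f t = (\<lambda>\<omega>. indicator ?N \<omega> * ?f t \<omega> + indicator (- ?N) \<omega> * ?f t \<omega>)" for t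
    by (auto simp: indicator_def)
  show "integrable lborel (?f t)"
    by (subst split) (intro Bochner_Integration.integrable_add int1 int2)
  define I1 where "I1 = (\<lambda>t. LINT \<omega>|lborel. indicator ?N \<omega> * ?f t \<omega>)"
  define I2 where "I2 = (\<lambda>t. LINT \<omega>|lborel. indicator (- ?N) \<omega> * ?f t \<omega>)"
  have I: "(LINT \<omega>|lborel. ?f t \<omega>) = I1 t + I2 t" for t
    unfolding I1_def I2_def by (subst split) (intro Bochner_Integration.integral_add int1 int2)
  have "((\<lambda>t. I2 t * ln t / t) \<longlongrightarrow> 0) at_top"
  proof (rule Lim_null_comparison)
    show "\<forall>\<^sub>F t in at_top. norm (I2 t * ln t / t) \<le> (LINT \<omega>|lborel. q \<omega>) * (ln t / t)"
      using eventually_ge_at_top[of 1]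
    proof eventually_elim
      case (elim t)
      have "I2 t \<le> (LINT \<omega>|lborel. q \<omega>)"
        unfolding I2_def by (intro integral_mono int2 q fq)
      moreover have "0 \<le> I2 t"
        unfolding I2_def by (intro Bochner_Integration.integral_nonneg mult_nonneg_nonneg fnn) simp
      ultimately show ?case using elim
        by (simp add: abs_mult divide_right_mono mult_right_mono)
    qed
    show "((\<lambda>t. (LINT \<omega>|lborel. q \<omega>) * (ln t / t)) \<longlongrightarrow> 0) at_top"
      by (rule tendsto_mult_right_zero) real_asymp
  qed
  moreover have "((\<lambda>t. I1 t * ln t / t) \<longlongrightarrow> (LINT x|lborel. 2 * (1 - cos x) / x\<^sup>2 * L)) at_top"
  proof -
    \<comment> \<open>The rescaled integrand: the Jacobian 1 / t and the normalisation ln t / t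
      leave ln t / t^2, whose t^2 cancels against the one from (x / t)^2 in the denominator of the
      kernel.\<close>
    define s where "s = (\<lambda>t x. indicator ?N (x / t) * (2 * (1 - cos x) / x\<^sup>2 * (r (x / t) * ln t)))"
    have eq: "I1 t * ln t / t = (LINT x|lborel. s t x)" if "t > 0" for t
    proof -
      have "I1 t = (1 / t) * (LINT x|lborel. indicator ?N (x / t) * ?f t (x / t))"
        unfolding I1_def using that
        by (subst lborel_integral_real_affine[where c="1 / t" and t=0]) auto
      then have "I1 t * ln t / t = (LINT x|lborel. indicator ?N (x / t) * ?f t (x / t)) * (ln t / t\<^sup>2)"
        by (simp add: power2_eq_square)
      also have "\<dots> = (LINT x|lborel. indicator ?N (x / t) * ?f t (x / t) * (ln t / t\<^sup>2))"
        by (simp only: integral_mult_left_zero)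
      also have "\<dots> = (LINT x|lborel. s t x)"
        using that by (intro Bochner_Integration.integral_cong) (auto simp: s_def power_divide)
      finally show ?thesis .
    qed
    have "((\<lambda>t. LINT x|lborel. s t x) \<longlongrightarrow> (LINT x|lborel. 2 * (1 - cos x) / x\<^sup>2 * L)) at_top"
    proof (rule integral_dominated_convergence_at_top)
      show "integrable lborel (\<lambda>x. 2 * L * (2 * (1 - cos x) / x\<^sup>2 * (1 + max 0 (ln \<bar>x\<bar>))))"
        by (intro integrable_mult_right integrable_fejer_log)
      show "\<forall>\<^sub>F t in at_top. AE x in lborel. norm (s t x) \<le> 2 * L * (2 * (1 - cos x) / x\<^sup>2 * (1 + max 0 (ln \<bar>x\<bar>)))"
        using eventually_ge_at_top[of 1]
      proof eventually_elim
        case (elim t)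
        show ?case
        proof (rule AE_I2)
          fix x :: real
          have w: "0 \<le> 2 * (1 - cos x) / x\<^sup>2" by simp
          show "norm (s t x) \<le> 2 * L * (2 * (1 - cos x) / x\<^sup>2 * (1 + max 0 (ln \<bar>x\<bar>)))"
          proof (cases "x = 0 \<or> x / t \<notin> ?N")
            case True
            then show ?thesis using L by (auto simp: s_def)
          next
            case False
            then have x: "x \<noteq> 0" "\<bar>x / t\<bar> < \<delta>" by auto
            define l where "l = ln (1 / \<bar>x / t\<bar>)"
            have "\<bar>x / t\<bar> \<le> exp (-1)" using x \<delta> by linarith
            then have "exp 1 \<le> 1 / \<bar>x / t\<bar>"
              using x elim by (simp add: exp_minus field_simps)
            then have l1: "1 \<le> l"
              unfolding l_def using x elim by (subst ln_ge_iff) auto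
            have l2: "ln t = l + ln \<bar>x\<bar>"
              using x elim by (simp add: l_def ln_div abs_divide)
            have rl: "r (x / t) * l \<le> 2 * L"
              using r\<delta>[of "x / t"] x elim by (simp add: l_def)
            \<comment> \<open>Turns the additive correction into a factor, by l \<ge> 1, so that the
              bound on \<open>r (x / t) * l\<close> applies.\<close>
            have "ln t \<le> l * (1 + max 0 (ln \<bar>x\<bar>))"
            proof -
              have "1 * max 0 (ln \<bar>x\<bar>) \<le> l * max 0 (ln \<bar>x\<bar>)"
                using l1 by (intro mult_right_mono) auto
              then show ?thesis unfolding l2 by (simp add: algebra_simps)
            qed
            then have "r (x / t) * ln t \<le> r (x / t) * (l * (1 + max 0 (ln \<bar>x\<bar>)))"
              by (intro mult_left_mono nonneg)
            also have "\<dots> \<le> 2 * L * (1 + max 0 (ln \<bar>x\<bar>))"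
              unfolding mult.assoc[symmetric] using rl by (intro mult_right_mono) auto
            finally have "2 * (1 - cos x) / x\<^sup>2 * (r (x / t) * ln t) \<le>
                2 * (1 - cos x) / x\<^sup>2 * (2 * L * (1 + max 0 (ln \<bar>x\<bar>)))"
              by (rule mult_left_mono[OF _ w])
            moreover have "s t x = 2 * (1 - cos x) / x\<^sup>2 * (r (x / t) * ln t)"
              using x by (simp add: s_def)
            moreover have "0 \<le> s t x"
              using elim by (simp add: s_def nonneg)
            ultimately show ?thesis
              unfolding mult.left_commute[of "2 * L"] real_norm_def by linarith
          qed
        qed
      qed
      show "AE x in lborel. ((\<lambda>t. s t x) \<longlongrightarrow> 2 * (1 - cos x) / x\<^sup>2 * L) at_top"
      proof (rule AE_I2)
        fix x :: real
        show "((\<lambda>t. s t x) \<longlongrightarrow> 2 * (1 - cos x) / x\<^sup>2 * L) at_top"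
        proof (cases "x = 0")
          case True
          then show ?thesis by (simp add: s_def)
        next
          case False
          have x0: "((\<lambda>t. x / t) \<longlongrightarrow> 0) at_top"
            by real_asymp
          have xat: "filterlim (\<lambda>t. x / t) (at 0) at_top"
            using x0 False eventually_gt_at_top[of 0] by (auto simp: filterlim_at elim!: eventually_mono)
          \<comment> \<open>This ratio exchanges the logarithm of the hypothesis,
            \<open>ln (1 / \<bar>x / t\<bar>)\<close>, for \<open>ln t\<close>.\<close>
          have "((\<lambda>t. ln t / (ln t - ln \<bar>x\<bar>)) \<longlongrightarrow> 1) at_top"
            by real_asymp
          then have "((\<lambda>t. 2 * (1 - cos x) / x\<^sup>2 * ((r (x / t) * ln (1 / \<bar>x / t\<bar>)) * (ln t / (ln t - ln \<bar>x\<bar>))))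
              \<longlongrightarrow> 2 * (1 - cos x) / x\<^sup>2 * (L * 1)) at_top"
            by (intro tendsto_intros filterlim_compose[OF lim xat])
          \<comment> \<open>Beyond |x| / \<delta> the point x / t lies in \<open>?N\<close>; as
            \<delta> \<le> 1, also t > |x|, so the denominator
            \<open>ln t - ln \<bar>x\<bar>\<close> is not 0 and cancels.\<close>
          moreover have "\<forall>\<^sub>F t in at_top. 2 * (1 - cos x) / x\<^sup>2 * ((r (x / t) * ln (1 / \<bar>x / t\<bar>)) * (ln t / (ln t - ln \<bar>x\<bar>))) = s t x"
            using eventually_gt_at_top[of "\<bar>x\<bar> / \<delta>"]
          proof eventually_elim
            case (elim t)
            then have t: "0 < t" using \<delta> False by (meson abs_ge_zero divide_nonneg_pos order_le_less_trans)
            have "\<bar>x\<bar> < t"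
            proof -
              have "\<delta> \<le> 1" using \<delta>(2) by (rule order_trans) simp
              then have "t * \<delta> \<le> t" using t by (simp add: mult_left_le)
              then show ?thesis using elim \<delta> by (simp add: field_simps)
            qed
            then have "ln \<bar>x\<bar> < ln t" using False t by simp
            moreover have "ln (1 / \<bar>x / t\<bar>) = ln t - ln \<bar>x\<bar>" using False t by (simp add: ln_div abs_divide)
            moreover have "x / t \<in> ?N" using elim \<delta> t by (simp add: field_simps)
            ultimately show ?case by (simp add: s_def)
          qed
          ultimately show ?thesis by (simp add: tendsto_cong)
        qed
      qed
    qed (auto simp: s_def)
    moreover have "\<forall>\<^sub>F t in at_top. (LINT x|lborel. s t x) = I1 t * ln t / t"
      using eventually_gt_at_top[of 0] by eventually_elim (simp add: eq)
    ultimately show ?thesis by (simp add: tendsto_cong)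
  qed
  ultimately have "((\<lambda>t. I2 t * ln t / t + I1 t * ln t / t) \<longlongrightarrow> 0 + (LINT x|lborel. 2 * (1 - cos x) / x\<^sup>2 * L)) at_top"
    by (rule tendsto_add)
  then have "((\<lambda>t. (LINT \<omega>|lborel. ?f t \<omega>) / (t / ln t)) \<longlongrightarrow> (LINT x|lborel. 2 * (1 - cos x) / x\<^sup>2) * L) at_top"
    unfolding I integral_mult_left_zero by (simp add: distrib_right add_divide_distrib add.commute)
  moreover have "(LINT x::real|lborel. 2 * (1 - cos x) / x\<^sup>2) > 0"
  proof (rule integral_fejer_pos, rule Bochner_Integration.integrable_bound[OF integrable_fejer_log])
    show "AE x::real in lborel. norm (2 * (1 - cos x) / x\<^sup>2) \<le> norm (2 * (1 - cos x) / x\<^sup>2 * (1 + max 0 (ln \<bar>x\<bar>)))"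
    proof (rule AE_I2)
      fix x :: real
      have "norm (2 * (1 - cos x) / x\<^sup>2) * 1 \<le> norm (2 * (1 - cos x) / x\<^sup>2) * norm (1 + max 0 (ln \<bar>x\<bar>))"
        by (intro mult_left_mono) auto
      then show "norm (2 * (1 - cos x) / x\<^sup>2) \<le> norm (2 * (1 - cos x) / x\<^sup>2 * (1 + max 0 (ln \<bar>x\<bar>)))"
        by (simp only: norm_mult mult_1_right)
    qed
  qed measurable
  ultimately show "(\<lambda>t. LINT \<omega>|lborel. ?f t \<omega>) \<asymp>\<^sub>c (\<lambda>t. t / ln t)"
    unfolding asymp_const_def using L by (intro exI[of _ "(LINT x|lborel. 2 * (1 - cos x) / x\<^sup>2) * L"]) auto
qed

section \<open>Trigonometric transforms of kernels with tail c / t\<close>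

lemma integral_cos_bound:
  assumes "a \<le> b" "\<omega> \<noteq> 0" shows "\<bar>integral {a..b} (\<lambda>t::real. cos (t * \<omega>))\<bar> \<le> 2 / \<bar>\<omega>\<bar>"
proof -
  have "((\<lambda>t. cos (t * \<omega>)) has_integral (sin (b * \<omega>) / \<omega> - sin (a * \<omega>) / \<omega>)) {a..b}"
    using assms by (intro fundamental_theorem_of_calculus)
      (auto intro!: derivative_eq_intros simp flip: has_real_derivative_iff_has_vector_derivative)
  then have "integral {a..b} (\<lambda>t. cos (t * \<omega>)) = (sin (b * \<omega>) - sin (a * \<omega>)) / \<omega>"
    by (simp add: integral_unique diff_divide_distrib)
  moreover have "\<bar>sin (b * \<omega>) - sin (a * \<omega>)\<bar> \<le> 2"
    using abs_triangle_ineq4[of "sin (b * \<omega>)" "sin (a * \<omega>)"]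
      add_mono[OF abs_sin_le_one[of "b * \<omega>"] abs_sin_le_one[of "a * \<omega>"]] by simp
  ultimately show ?thesis by (simp add: divide_right_mono)
qed

lemma integral_sin_bound:
  assumes "a \<le> b" "\<omega> \<noteq> 0" shows "\<bar>integral {a..b} (\<lambda>t::real. sin (t * \<omega>))\<bar> \<le> 2 / \<bar>\<omega>\<bar>"
proof -
  have "((\<lambda>t. sin (t * \<omega>)) has_integral (- cos (b * \<omega>) / \<omega> - - cos (a * \<omega>) / \<omega>)) {a..b}"
    using assms by (intro fundamental_theorem_of_calculus)
      (auto intro!: derivative_eq_intros simp flip: has_real_derivative_iff_has_vector_derivative)
  then have "integral {a..b} (\<lambda>t. sin (t * \<omega>)) = (cos (a * \<omega>) - cos (b * \<omega>)) / \<omega>"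
    by (simp add: integral_unique diff_divide_distrib)
  moreover have "\<bar>cos (a * \<omega>) - cos (b * \<omega>)\<bar> \<le> 2"
    using abs_triangle_ineq4[of "cos (a * \<omega>)" "cos (b * \<omega>)"]
      add_mono[OF abs_cos_le_one[of "a * \<omega>"] abs_cos_le_one[of "b * \<omega>"]] by simp
  ultimately show ?thesis by (simp add: divide_right_mono)
qed

text \<open>Second mean value theorem: the integral is \<open>k a\<close> times one partial integral
  of f plus \<open>k b\<close> times another, each at most C in absolute value. The theorem is
  applied to -k because it asks for an increasing factor. The bound does not depend on b.\<close>

lemma integral_monotone_oscillating_bound:
  fixes k f :: "real \<Rightarrow> real"
  assumes "a \<le> b" and anti: "antimono_on {a..} k" and nn: "\<And>t. a \<le> t \<Longrightarrow> 0 \<le> k t"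
    and f: "f integrable_on {a..b}" and C: "\<And>a b. a \<le> b \<Longrightarrow> \<bar>integral {a..b} f\<bar> \<le> C"
  shows "\<bar>integral {a..b} (\<lambda>t. k t * f t)\<bar> \<le> 2 * C * k a"
proof -
  obtain c where c: "c \<in> {a..b}"
    "integral {a..b} (\<lambda>x. - k x * f x) = - k a * integral {a..c} f + - k b * integral {c..b} f"
    by (rule second_mean_value_theorem[OF f \<open>a \<le> b\<close>, of "\<lambda>t. - k t"])
      (use anti in \<open>auto simp: monotone_on_def\<close>)
  have 1: "\<bar>integral {a..c} f\<bar> \<le> C" "\<bar>integral {c..b} f\<bar> \<le> C"
    using c(1) by (auto intro: C)
  have "integral {a..b} (\<lambda>x. k x * f x) = k a * integral {a..c} f + k b * integral {c..b} f"
    using c(2) by simp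
  also have "\<bar>\<dots>\<bar> \<le> \<bar>k a\<bar> * \<bar>integral {a..c} f\<bar> + \<bar>k b\<bar> * \<bar>integral {c..b} f\<bar>"
    by (rule order_trans[OF abs_triangle_ineq]) (simp add: abs_mult)
  also have "\<dots> \<le> k a * C + k a * C"
    using 1 nn[of a] nn[of b] \<open>a \<le> b\<close> monotone_onD[OF anti, of a b]
    by (intro add_mono mult_mono) auto
  finally show ?thesis by simp
qed

lemma integrable_mult_bounded_continuous:
  fixes k f :: "real \<Rightarrow> real"
  assumes "k absolutely_integrable_on {a..b}" "continuous_on UNIV f" "\<And>t. \<bar>f t\<bar> \<le> B"
  shows "(\<lambda>t. k t * f t) absolutely_integrable_on {a..b}"
proof -
  have "(\<lambda>t. f t * k t) absolutely_integrable_on {a..b}"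
  proof (rule absolutely_integrable_bounded_measurable_product_real)
    show "f \<in> borel_measurable (lebesgue_on {a..b})"
      using assms(2) by (intro continuous_imp_measurable_on_sets_lebesgue) (auto intro: continuous_on_subset)
    show "bounded (f ` {a..b})" using assms(3) by (auto simp: bounded_iff)
  qed (use assms(1) in auto)
  then show ?thesis by (simp add: mult.commute)
qed

text \<open>Dirichlet's test with an explicit remainder, which later gives the estimate at the
  frequency-dependent cut. Completeness is used along the integers, and the remainder bound carries
  the limit over to real T.\<close>

lemma oscillating_integral_converges:
  fixes k f :: "real \<Rightarrow> real"
  assumes A: "0 \<le> A" and anti: "antimono_on {A..} k" and nn: "\<And>t. A \<le> t \<Longrightarrow> 0 \<le> k t"
    and k0: "(k \<longlongrightarrow> 0) at_top" and k: "\<And>T. k absolutely_integrable_on {0..T}"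
    and f: "continuous_on UNIV f" "\<And>t. \<bar>f t\<bar> \<le> B"
    and C: "\<And>a b. a \<le> b \<Longrightarrow> \<bar>integral {a..b} f\<bar> \<le> C"
  shows "\<exists>l. ((\<lambda>T. integral {0..T} (\<lambda>t. k t * f t)) \<longlongrightarrow> l) at_top \<and>
    (\<forall>T\<ge>A. \<bar>integral {0..T} (\<lambda>t. k t * f t) - l\<bar> \<le> 2 * C * k T)"
proof -
  define J where "J = (\<lambda>T. integral {0..T} (\<lambda>t. k t * f t))"
  have int: "(\<lambda>t. k t * f t) integrable_on {0..T}" for T
    using integrable_mult_bounded_continuous[OF k f] by (simp add: absolutely_integrable_on_def)
  have J: "\<bar>J S - J T\<bar> \<le> 2 * C * k T" if "A \<le> T" "T \<le> S" for S T
  proof -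
    have "J T + integral {T..S} (\<lambda>t. k t * f t) = J S"
      unfolding J_def using that A by (intro Henstock_Kurzweil_Integration.integral_combine int) auto
    moreover have "\<bar>integral {T..S} (\<lambda>t. k t * f t)\<bar> \<le> 2 * C * k T"
    proof (rule integral_monotone_oscillating_bound[OF that(2) _ _ _ C])
      show "antimono_on {T..} k" using anti that by (auto intro: monotone_on_subset)
      show "f integrable_on {T..S}"
        using f(1) by (intro integrable_continuous_real) (auto intro: continuous_on_subset)
    qed (use nn that in auto)
    ultimately show ?thesis by linarith
  qed
  have small: "((\<lambda>T. 2 * C * k T) \<longlongrightarrow> 0) at_top"
    using k0 by (rule tendsto_mult_right_zero)
  have "Cauchy (\<lambda>n. J (real n))"
  proof (rule metric_CauchyI)
    fix e :: real assume "0 < e"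
    have "\<forall>\<^sub>F T in at_top. 2 * C * k T < e / 2"
      using order_tendstoD(2)[OF small, of "e / 2"] \<open>0 < e\<close> by simp
    then obtain T0 where "\<And>T. T \<ge> T0 \<Longrightarrow> 2 * C * k T < e / 2"
      unfolding eventually_at_top_linorder by blast
    then have "2 * C * k (max A T0) < e / 2" by simp
    then obtain T where T: "T \<ge> A" "2 * C * k T < e / 2"
      using max.cobounded1 by blast
    obtain N where N: "T \<le> real N" using real_arch_simple by blast
    have "dist (J (real m)) (J (real n)) < e" if "m \<ge> N" "n \<ge> N" for m n
    proof -
      have "T \<le> real m" "T \<le> real n" using N that by auto
      then show ?thesis
        using J[OF T(1), of "real m"] J[OF T(1), of "real n"] T(2) by (auto simp: dist_real_def)
    qed
    then show "\<exists>N. \<forall>m\<ge>N. \<forall>n\<ge>N. dist (J (real m)) (J (real n)) < e" by blast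
  qed
  then obtain l where l: "(\<lambda>n. J (real n)) \<longlonglongrightarrow> l"
    using Cauchy_convergent convergent_def by blast
  have b: "\<bar>J T - l\<bar> \<le> 2 * C * k T" if "A \<le> T" for T
  proof (rule tendsto_upperbound)
    show "(\<lambda>n. \<bar>J T - J (real n)\<bar>) \<longlonglongrightarrow> \<bar>J T - l\<bar>"
      by (intro tendsto_intros l)
    show "\<forall>\<^sub>F n in sequentially. \<bar>J T - J (real n)\<bar> \<le> 2 * C * k T"
      using eventually_ge_at_top[of "nat \<lceil>T\<rceil>"]
    proof eventually_elim
      case (elim n)
      then have "T \<le> real n" by linarith
      from J[OF that this] show ?case by (simp add: abs_minus_commute)
    qed
  qed simp
  have "((\<lambda>T. J T - l) \<longlongrightarrow> 0) at_top"
    by (rule Lim_null_comparison[OF _ small], rule eventually_mono[OF eventually_ge_at_top[of A]])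
      (simp add: b)
  then have "(J \<longlongrightarrow> l) at_top" using LIM_zero_cancel by blast
  with b show ?thesis unfolding J_def by blast
qed

text \<open>Beyond some B the integrand differs from c / t by at most e / (2 t), and 1 / t
  integrates to ln T - ln B. All else stays fixed and is swallowed by ln T.\<close>

lemma integral_asymp_ln:
  fixes k :: "real \<Rightarrow> real"
  assumes k: "\<And>T. k integrable_on {0..T}" and lim: "((\<lambda>t. k t * t) \<longlongrightarrow> c) at_top"
  shows "((\<lambda>T. integral {0..T} k / ln T) \<longlongrightarrow> c) at_top"
proof (rule tendstoI)
  fix e :: real assume e: "0 < e"
  have "\<forall>\<^sub>F t in at_top. \<bar>k t * t - c\<bar> < e / 2"
    using tendstoD[OF lim, of "e / 2"] e by (simp add: dist_real_def)
  then obtain B0 where B0: "\<And>t. t \<ge> B0 \<Longrightarrow> \<bar>k t * t - c\<bar> < e / 2"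
    unfolding eventually_at_top_linorder by blast
  define B where "B = max 1 B0"
  have B: "B \<ge> 1" "\<And>t. t \<ge> B \<Longrightarrow> \<bar>k t * t - c\<bar> < e / 2"
    using B0 by (auto simp: B_def)
  \<comment> \<open>Collects the terms that do not depend on T: the integral up to B and the term c
    ln B. With B \<ge> 1 the logarithm here is nonnegative.\<close>
  define D where "D = \<bar>integral {0..B} k\<bar> + \<bar>c\<bar> * ln B"
  have bound: "\<bar>integral {0..T} k - c * ln T\<bar> \<le> D + e / 2 * ln T" if T: "T \<ge> B" for T
  proof -
    have "((\<lambda>t. 1 / t) has_integral (ln T - ln B)) {B..T}"
    proof (rule fundamental_theorem_of_calculus[OF T])
      fix t assume "t \<in> {B..T}"
      then have "0 < t" using B(1) by simp
      from DERIV_ln_divide[OF this] show "(ln has_vector_derivative 1 / t) (at t within {B..T})"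
        unfolding has_real_derivative_iff_has_vector_derivative
        by (rule has_vector_derivative_at_within)
    qed
    note 1 = has_integral_mult_right[OF this]
    have kBT: "k integrable_on {B..T}"
      using k[of T] by (rule integrable_on_subinterval) (use B(1) in auto)
    have "norm (integral {B..T} (\<lambda>t. k t - c * (1 / t))) \<le> integral {B..T} (\<lambda>t. e / 2 * (1 / t))"
    proof (rule Henstock_Kurzweil_Integration.integral_norm_bound_integral)
      show "(\<lambda>t. k t - c * (1 / t)) integrable_on {B..T}"
        by (intro Henstock_Kurzweil_Integration.integrable_diff kBT has_integral_integrable[OF 1])
      show "(\<lambda>t. e / 2 * (1 / t)) integrable_on {B..T}"
        by (rule has_integral_integrable[OF 1])
      fix t assume "t \<in> {B..T}"
      then have t: "0 < t" "\<bar>k t * t - c\<bar> < e / 2" using B by auto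
      have "k t - c * (1 / t) = (k t * t - c) / t"
        using t(1) by (simp add: field_simps)
      then have "\<bar>k t - c * (1 / t)\<bar> = \<bar>k t * t - c\<bar> / t"
        using t(1) by (simp add: abs_divide)
      also have "\<dots> \<le> e / 2 / t" using t by (intro divide_right_mono) auto
      finally show "norm (k t - c * (1 / t)) \<le> e / 2 * (1 / t)" by simp
    qed
    also have "\<dots> = e / 2 * (ln T - ln B)" by (rule integral_unique[OF 1])
    finally have "\<bar>integral {B..T} (\<lambda>t. k t - c * (1 / t))\<bar> \<le> e / 2 * (ln T - ln B)"
      unfolding real_norm_def .
    moreover have "integral {B..T} (\<lambda>t. k t - c * (1 / t)) = integral {B..T} k - c * (ln T - ln B)"
      using Henstock_Kurzweil_Integration.integral_diff[OF kBT has_integral_integrable[OF 1[of c]]]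
      unfolding integral_unique[OF 1[of c]] .
    moreover have "integral {0..B} k + integral {B..T} k = integral {0..T} k"
      using B(1) T by (intro Henstock_Kurzweil_Integration.integral_combine k) auto
    moreover have "0 \<le> e / 2 * ln B" "\<bar>c * ln B\<bar> = \<bar>c\<bar> * ln B" using e B(1) by (auto simp: abs_mult)
    ultimately show ?thesis unfolding D_def right_diff_distrib by linarith
  qed
  have "\<forall>\<^sub>F T in at_top. D / ln T < e / 2"
  proof (rule order_tendstoD)
    show "((\<lambda>T. D / ln T) \<longlongrightarrow> 0) at_top" by real_asymp
  qed (use e in simp)
  then show "\<forall>\<^sub>F T in at_top. dist (integral {0..T} k / ln T) c < e"
    using eventually_ge_at_top[of B] eventually_gt_at_top[of 1]
  proof eventually_elim
    case (elim T)
    then have l: "ln T > 0" by simp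
    have "integral {0..T} k / ln T - c = (integral {0..T} k - c * ln T) / ln T"
      using l by (simp add: field_simps)
    then have "dist (integral {0..T} k / ln T) c = \<bar>integral {0..T} k - c * ln T\<bar> / ln T"
      using l by (simp add: dist_real_def abs_divide)
    also have "\<dots> \<le> (D + e / 2 * ln T) / ln T"
      using bound[OF elim(2)] l by (intro divide_right_mono) auto
    also have "\<dots> = D / ln T + e / 2" using l by (simp add: add_divide_distrib)
    finally show ?case using elim(1) by linarith
  qed
qed

text \<open>The properties shared by cosine and sine, so that both transforms are estimated at once.
  What separates them is the value \<open>g 0\<close>, the coefficient of the logarithmic main
  term.\<close>

locale trig_like =
  fixes g :: "real \<Rightarrow> real"
  assumes abs_le_1: "\<bar>g x\<bar> \<le> 1"
    and lipschitz: "\<bar>g x - g y\<bar> \<le> \<bar>x - y\<bar>"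
    and integral_bound: "a \<le> b \<Longrightarrow> \<omega> \<noteq> 0 \<Longrightarrow> \<bar>integral {a..b} (\<lambda>t. g (t * \<omega>))\<bar> \<le> 2 / \<bar>\<omega>\<bar>"
begin

lemma continuous_trig: "continuous_on S (\<lambda>t. g (t * \<omega>))"
proof -
  have "1-lipschitz_on UNIV g" by (rule lipschitz_onI) (auto simp: dist_real_def lipschitz)
  then have "continuous_on UNIV g" by (rule lipschitz_on_continuous_on)
  then show ?thesis
    by (rule continuous_on_compose2[of UNIV]) (auto intro!: continuous_intros)
qed

end

lemma trig_like_cos: "trig_like cos"
proof
  fix x y :: real
  have "\<bar>cos x - cos y\<bar> = 2 * (\<bar>sin ((x + y) / 2)\<bar> * \<bar>sin ((y - x) / 2)\<bar>)"
    by (simp add: cos_diff_cos abs_mult)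
  also have "\<dots> \<le> 2 * (1 * \<bar>(y - x) / 2\<bar>)"
    by (intro mult_left_mono mult_mono abs_sin_x_le_abs_x) auto
  finally show "\<bar>cos x - cos y\<bar> \<le> \<bar>x - y\<bar>" by simp
qed (auto simp: integral_cos_bound)

lemma trig_like_sin: "trig_like sin"
proof
  fix x y :: real
  have "\<bar>sin x - sin y\<bar> = 2 * (\<bar>sin ((x - y) / 2)\<bar> * \<bar>cos ((x + y) / 2)\<bar>)"
    by (simp add: sin_diff_sin abs_mult)
  also have "\<dots> \<le> 2 * (\<bar>(x - y) / 2\<bar> * 1)"
    by (intro mult_left_mono mult_mono abs_sin_x_le_abs_x) auto
  finally show "\<bar>sin x - sin y\<bar> \<le> \<bar>x - y\<bar>" by simp
qed (auto simp: integral_sin_bound)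

locale log_kernel =
  fixes k :: "real \<Rightarrow> real" and A c :: real
  assumes locally_integrable: "locally_integrable k"
    and A_nonneg: "0 \<le> A"
    and antimono: "antimono_on {A..} k"
    and nonneg: "A \<le> t \<Longrightarrow> 0 \<le> k t"
    and c_pos: "0 < c"
    and tail: "((\<lambda>t. k t * t) \<longlongrightarrow> c) at_top"
begin

lemma abs_int: "k absolutely_integrable_on {a..b}"
  using locally_integrable by (simp add: locally_integrable_def)

lemma int_abs: "(\<lambda>t. \<bar>k t\<bar>) integrable_on {a..b}"
  using abs_int[of a b] by (simp add: absolutely_integrable_on_def)

lemma tendsto_0: "(k \<longlongrightarrow> 0) at_top"
proof -
  have "((\<lambda>t. k t * t * (1 / t)) \<longlongrightarrow> c * 0) at_top"
    by (intro tendsto_mult tail) real_asymp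
  moreover have "\<forall>\<^sub>F t in at_top. k t * t * (1 / t) = k t"
    using eventually_gt_at_top[of 0] by eventually_elim auto
  ultimately show ?thesis by (simp add: tendsto_cong)
qed

definition trig_transform :: "(real \<Rightarrow> real) \<Rightarrow> real \<Rightarrow> real" where
  "trig_transform g \<omega> = Lim at_top (\<lambda>T. integral {0..T} (\<lambda>t. k t * g (t * \<omega>)))"

context
  fixes g assumes g: "trig_like g"
begin

interpretation trig_like g by (rule g)

lemma int_trig: "(\<lambda>t. k t * g (t * \<omega>)) integrable_on {0..T}"
  using integrable_mult_bounded_continuous[OF abs_int continuous_trig abs_le_1]
  by (simp add: absolutely_integrable_on_def)

text \<open>Dirichlet's test with C = 2 / |\<omega>|, the bound on integrals of the oscillating
  factor; hence the constant 4.\<close>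

lemma trig_transform_converges:
  assumes "\<omega> \<noteq> 0"
  shows "((\<lambda>T. integral {0..T} (\<lambda>t. k t * g (t * \<omega>))) \<longlongrightarrow> trig_transform g \<omega>) at_top"
    and "A \<le> T \<Longrightarrow> \<bar>integral {0..T} (\<lambda>t. k t * g (t * \<omega>)) - trig_transform g \<omega>\<bar> \<le> 4 * k T / \<bar>\<omega>\<bar>"
proof -
  obtain l where l: "((\<lambda>T. integral {0..T} (\<lambda>t. k t * g (t * \<omega>))) \<longlongrightarrow> l) at_top"
    "\<forall>T\<ge>A. \<bar>integral {0..T} (\<lambda>t. k t * g (t * \<omega>)) - l\<bar> \<le> 2 * (2 / \<bar>\<omega>\<bar>) * k T"
    using oscillating_integral_converges[OF A_nonneg antimono nonneg tendsto_0 abs_int continuous_trig abs_le_1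
        integral_bound, of \<omega>] assms by blast
  moreover have "trig_transform g \<omega> = l"
    unfolding trig_transform_def using l(1) by (intro tendsto_Lim) auto
  ultimately show "((\<lambda>T. integral {0..T} (\<lambda>t. k t * g (t * \<omega>))) \<longlongrightarrow> trig_transform g \<omega>) at_top"
    "A \<le> T \<Longrightarrow> \<bar>integral {0..T} (\<lambda>t. k t * g (t * \<omega>)) - trig_transform g \<omega>\<bar> \<le> 4 * k T / \<bar>\<omega>\<bar>"
    by auto
qed

text \<open>The truncated transforms are Lipschitz in \<omega>, and the transform is their pointwise
  limit off 0. At 0 the truncations may diverge, so the approximants are redefined there to equal
  the value of the \<open>Lim\<close> expression.\<close>

lemma trig_transform_measurable: "trig_transform g \<in> borel_measurable borel"
proof (rule borel_measurable_LIMSEQ_real)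
  let ?J = "\<lambda>n \<omega>. integral {0..real n} (\<lambda>t. k t * g (t * \<omega>))"
  fix n
  have "continuous_on UNIV (?J n)"
  proof (rule lipschitz_on_continuous_on, rule lipschitz_onI)
    show "0 \<le> integral {0..real n} (\<lambda>t. \<bar>k t\<bar>) * real n"
      by (intro mult_nonneg_nonneg Henstock_Kurzweil_Integration.integral_nonneg int_abs) auto
    fix \<omega> \<eta> :: real
    have "norm (integral {0..real n} (\<lambda>t. k t * g (t * \<omega>) - k t * g (t * \<eta>))) \<le>
      integral {0..real n} (\<lambda>t. \<bar>k t\<bar> * (real n * \<bar>\<omega> - \<eta>\<bar>))"
    proof (rule Henstock_Kurzweil_Integration.integral_norm_bound_integral)
      fix t assume t: "t \<in> {0..real n}"
      have "\<bar>g (t * \<omega>) - g (t * \<eta>)\<bar> \<le> t * \<bar>\<omega> - \<eta>\<bar>"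
        using lipschitz[of "t * \<omega>" "t * \<eta>"] t by (simp add: abs_mult flip: right_diff_distrib)
      also have "\<dots> \<le> real n * \<bar>\<omega> - \<eta>\<bar>" using t by (intro mult_right_mono) auto
      finally show "norm (k t * g (t * \<omega>) - k t * g (t * \<eta>)) \<le> \<bar>k t\<bar> * (real n * \<bar>\<omega> - \<eta>\<bar>)"
        by (simp add: abs_mult mult_left_mono flip: right_diff_distrib)
    qed (intro Henstock_Kurzweil_Integration.integrable_diff int_trig integrable_on_mult_left int_abs)+
    then show "dist (?J n \<omega>) (?J n \<eta>) \<le> integral {0..real n} (\<lambda>t. \<bar>k t\<bar>) * real n * dist \<omega> \<eta>"
      unfolding Henstock_Kurzweil_Integration.integral_diff[OF int_trig int_trig]
      by (simp add: dist_real_def mult_ac)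
  qed
  then show "(\<lambda>\<omega>. if \<omega> = 0 then trig_transform g 0 else ?J n \<omega>) \<in> borel_measurable borel"
    by (intro measurable_If borel_measurable_continuous_onI) auto
next
  fix \<omega>
  show "(\<lambda>n. if \<omega> = 0 then trig_transform g 0 else integral {0..real n} (\<lambda>t. k t * g (t * \<omega>)))
    \<longlonglongrightarrow> trig_transform g \<omega>"
    using filterlim_compose[OF trig_transform_converges(1) filterlim_real_sequentially, of \<omega>]
    by (cases "\<omega> = 0") simp_all
qed

text \<open>Cut at T = A: the head is controlled by the integral of |k|, the tail by the Dirichlet
  remainder. This serves the bound on the density at high frequencies.\<close>

lemma trig_transform_bounded:
  assumes "1 \<le> \<bar>\<omega>\<bar>"
  shows "\<bar>trig_transform g \<omega>\<bar> \<le> integral {0..A} (\<lambda>t. \<bar>k t\<bar>) + 4 * k A"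
proof -
  have "norm (integral {0..A} (\<lambda>t. k t * g (t * \<omega>))) \<le> integral {0..A} (\<lambda>t. \<bar>k t\<bar>)"
    by (rule Henstock_Kurzweil_Integration.integral_norm_bound_integral[OF int_trig int_abs])
      (simp add: abs_mult mult_left_le abs_le_1)
  moreover have "\<bar>integral {0..A} (\<lambda>t. k t * g (t * \<omega>)) - trig_transform g \<omega>\<bar> \<le> 4 * k A / \<bar>\<omega>\<bar>"
    using assms by (intro trig_transform_converges) auto
  moreover have "4 * k A / \<bar>\<omega>\<bar> \<le> 4 * k A"
    using assms nonneg[of A] by (simp add: divide_le_eq mult_left_le_one_le mult_le_cancel_left1)
  ultimately show ?thesis by simp
qed

text \<open>Both errors of the splitting stay bounded. Before the cut, |g (t \<omega>) - g 0| \<le>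
  t |\<omega>| offsets the size c / t of k, leaving an integrand of order |\<omega>| over a length 1
  / |\<omega>|. Beyond it, the remainder 4 k(T) / |\<omega>| is 4 k(T) T for T = 1 / |\<omega>|. The
  main term survives for cosine and vanishes for sine.\<close>

lemma trig_transform_near_0:
  "\<exists>D. \<forall>\<^sub>F \<omega> in at 0. \<bar>trig_transform g \<omega> - g 0 * integral {0..1 / \<bar>\<omega>\<bar>} k\<bar> \<le> D"
proof -
  have "\<forall>\<^sub>F t in at_top. k t * t < 2 * c"
    using order_tendstoD(2)[OF tail, of "2 * c"] c_pos by simp
  then obtain A0 where A0: "\<And>t. t \<ge> A0 \<Longrightarrow> k t * t < 2 * c"
    unfolding eventually_at_top_linorder by blast
  define A1 where "A1 = max (max A A0) 1"
  have A1: "A \<le> A1" "1 \<le> A1" "\<And>t. t \<ge> A1 \<Longrightarrow> k t * t \<le> 2 * c"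
    using A0 by (auto simp: A1_def intro: less_imp_le)
  define M where "M = integral {0..A1} (\<lambda>t. \<bar>k t\<bar>)"
  \<comment> \<open>Here 8 c bounds the tail beyond T, 2 c the Lipschitz error between A1 and T, and
    M the error on [0, A1], where t |\<omega>| \<le> 1.\<close>
  have "\<bar>trig_transform g \<omega> - g 0 * integral {0..1 / \<bar>\<omega>\<bar>} k\<bar> \<le> 10 * c + M"
    if \<omega>: "\<omega> \<noteq> 0" "\<bar>\<omega>\<bar> < 1 / A1" for \<omega>
  proof -
    define T where "T = 1 / \<bar>\<omega>\<bar>"
    have T: "A1 \<le> T" "T * \<bar>\<omega>\<bar> = 1" "0 < T"
      using \<omega> A1(2) by (auto simp: T_def field_simps)
    have "\<bar>integral {0..T} (\<lambda>t. k t * g (t * \<omega>)) - trig_transform g \<omega>\<bar> \<le> 4 * k T / \<bar>\<omega>\<bar>"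
      using T A1 \<omega> by (intro trig_transform_converges) auto
    also have "4 * k T / \<bar>\<omega>\<bar> = 4 * (k T * T)" by (simp add: T_def)
    also have "\<dots> \<le> 8 * c" using A1(3)[OF T(1)] by linarith
    finally have 1: "\<bar>integral {0..T} (\<lambda>t. k t * g (t * \<omega>)) - trig_transform g \<omega>\<bar> \<le> 8 * c" .
    have kT: "(\<lambda>t. k t * g 0) integrable_on {0..T}" "(\<lambda>t. \<bar>k t\<bar>) integrable_on {0..A1}"
      using int_trig[of 0 T] int_abs by auto
    have restr: "(\<lambda>t. if t \<in> {0..A1} then \<bar>k t\<bar> else 0) integrable_on {0..T}"
        "integral {0..T} (\<lambda>t. if t \<in> {0..A1} then \<bar>k t\<bar> else 0) = M"
    proof -
      have eq: "{0..A1} \<inter> {0..T} = {0..A1}" using T(1) by auto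
      show "(\<lambda>t. if t \<in> {0..A1} then \<bar>k t\<bar> else 0) integrable_on {0..T}"
          "integral {0..T} (\<lambda>t. if t \<in> {0..A1} then \<bar>k t\<bar> else 0) = M"
        unfolding integrable_restrict_Int integral_restrict_Int M_def eq using kT(2) by simp_all
    qed
    have "norm (integral {0..T} (\<lambda>t. k t * g (t * \<omega>) - k t * g 0)) \<le>
      integral {0..T} (\<lambda>t. (if t \<in> {0..A1} then \<bar>k t\<bar> else 0) + 2 * c * \<bar>\<omega>\<bar>)"
    proof (rule Henstock_Kurzweil_Integration.integral_norm_bound_integral)
      fix t assume t: "t \<in> {0..T}"
      have "\<bar>g (t * \<omega>) - g 0\<bar> \<le> t * \<bar>\<omega>\<bar>"
        using lipschitz[of "t * \<omega>" 0] t by (simp add: abs_mult)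
      then have *: "norm (k t * g (t * \<omega>) - k t * g 0) \<le> \<bar>k t\<bar> * (t * \<bar>\<omega>\<bar>)"
        by (simp add: abs_mult mult_left_mono flip: right_diff_distrib)
      show "norm (k t * g (t * \<omega>) - k t * g 0) \<le> (if t \<in> {0..A1} then \<bar>k t\<bar> else 0) + 2 * c * \<bar>\<omega>\<bar>"
      proof (cases "t \<in> {0..A1}")
        case True
        have "t * \<bar>\<omega>\<bar> \<le> 1" using mult_right_mono[of t T "\<bar>\<omega>\<bar>"] t T by simp
        then have "\<bar>k t\<bar> * (t * \<bar>\<omega>\<bar>) \<le> \<bar>k t\<bar> * 1" by (intro mult_left_mono) auto
        moreover have "0 \<le> 2 * c * \<bar>\<omega>\<bar>" using c_pos by simp
        ultimately show ?thesis using * True by simp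
      next
        case False
        then have "A1 \<le> t" using t by auto
        then have "\<bar>k t\<bar> * t \<le> 2 * c" using A1 nonneg[of t] by simp
        then have "\<bar>k t\<bar> * t * \<bar>\<omega>\<bar> \<le> 2 * c * \<bar>\<omega>\<bar>" by (intro mult_right_mono) auto
        then show ?thesis using * unfolding if_not_P[OF False] mult.assoc by linarith
      qed
    qed (intro Henstock_Kurzweil_Integration.integrable_diff Henstock_Kurzweil_Integration.integrable_add
          int_trig kT restr integrable_const_ivl)+
    also have "\<dots> = M + T * (2 * c * \<bar>\<omega>\<bar>)"
      using restr T by (subst Henstock_Kurzweil_Integration.integral_add) (auto intro: integrable_const_ivl)
    also have "T * (2 * c * \<bar>\<omega>\<bar>) = 2 * c * (T * \<bar>\<omega>\<bar>)" by simp
    also have "\<dots> = 2 * c" using T by simp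
    also have "integral {0..T} (\<lambda>t. k t * g (t * \<omega>) - k t * g 0) =
      integral {0..T} (\<lambda>t. k t * g (t * \<omega>)) - g 0 * integral {0..T} k"
      by (subst Henstock_Kurzweil_Integration.integral_diff[OF int_trig kT(1)]) simp
    finally show ?thesis using 1 unfolding T_def[symmetric] real_norm_def by linarith
  qed
  then have "\<forall>\<^sub>F \<omega> in at 0. \<bar>trig_transform g \<omega> - g 0 * integral {0..1 / \<bar>\<omega>\<bar>} k\<bar> \<le> 10 * c + M"
    using A1(2) unfolding eventually_at by (intro exI[of _ "1 / A1"]) (auto simp: dist_real_def)
  then show ?thesis ..
qed

end

section \<open>Logarithmic size of the two transforms near 0\<close>

lemma filterlim_ln_inverse_at_0: "filterlim (\<lambda>\<omega>::real. ln (1 / \<bar>\<omega>\<bar>)) at_top (at 0)"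
  by real_asymp

lemma cos_transform_log:
  "((\<lambda>\<omega>. trig_transform cos \<omega> / ln (1 / \<bar>\<omega>\<bar>)) \<longlongrightarrow> c) (at 0)"
proof -
  obtain D where D: "\<forall>\<^sub>F \<omega> in at 0. \<bar>trig_transform cos \<omega> - integral {0..1 / \<bar>\<omega>\<bar>} k\<bar> \<le> D"
    using trig_transform_near_0[OF trig_like_cos] by auto
  have inf: "filterlim (\<lambda>\<omega>::real. 1 / \<bar>\<omega>\<bar>) at_top (at 0)" by real_asymp
  have G: "((\<lambda>\<omega>. integral {0..1 / \<bar>\<omega>\<bar>} k / ln (1 / \<bar>\<omega>\<bar>)) \<longlongrightarrow> c) (at 0)"
    by (rule filterlim_compose[OF integral_asymp_ln[OF _ tail] inf])
      (use abs_int in \<open>auto simp: absolutely_integrable_on_def\<close>)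
  have "((\<lambda>\<omega>. (trig_transform cos \<omega> - integral {0..1 / \<bar>\<omega>\<bar>} k) / ln (1 / \<bar>\<omega>\<bar>)) \<longlongrightarrow> 0) (at 0)"
  proof (rule Lim_null_comparison)
    show "((\<lambda>\<omega>. D / ln (1 / \<bar>\<omega>\<bar>)) \<longlongrightarrow> 0) (at 0)"
      by (rule real_tendsto_divide_at_top[OF tendsto_const filterlim_ln_inverse_at_0])
    show "\<forall>\<^sub>F \<omega> in at 0. norm ((trig_transform cos \<omega> - integral {0..1 / \<bar>\<omega>\<bar>} k) / ln (1 / \<bar>\<omega>\<bar>)) \<le> D / ln (1 / \<bar>\<omega>\<bar>)"
      using D filterlim_at_top_dense[THEN iffD1, OF filterlim_ln_inverse_at_0, rule_format, of 0]
    proof eventually_elim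
      case (elim \<omega>)
      have "norm ((trig_transform cos \<omega> - integral {0..1 / \<bar>\<omega>\<bar>} k) / ln (1 / \<bar>\<omega>\<bar>)) =
        \<bar>trig_transform cos \<omega> - integral {0..1 / \<bar>\<omega>\<bar>} k\<bar> / ln (1 / \<bar>\<omega>\<bar>)"
        unfolding real_norm_def abs_divide using elim(2) by simp
      also have "\<dots> \<le> D / ln (1 / \<bar>\<omega>\<bar>)" using elim by (intro divide_right_mono) auto
      finally show ?case .
    qed
  qed
  from tendsto_add[OF this G] show ?thesis
    by (simp only: diff_divide_distrib diff_add_cancel add_0)
qed

lemma sin_transform_log:
  "((\<lambda>\<omega>. trig_transform sin \<omega> / ln (1 / \<bar>\<omega>\<bar>)) \<longlongrightarrow> 0) (at 0)"
proof -
  obtain D where D: "\<forall>\<^sub>F \<omega> in at 0. \<bar>trig_transform sin \<omega>\<bar> \<le> D"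
    using trig_transform_near_0[OF trig_like_sin] by auto
  show ?thesis
  proof (rule Lim_null_comparison)
    show "((\<lambda>\<omega>. D / ln (1 / \<bar>\<omega>\<bar>)) \<longlongrightarrow> 0) (at 0)"
      by (rule real_tendsto_divide_at_top[OF tendsto_const filterlim_ln_inverse_at_0])
    show "\<forall>\<^sub>F \<omega> in at 0. norm (trig_transform sin \<omega> / ln (1 / \<bar>\<omega>\<bar>)) \<le> D / ln (1 / \<bar>\<omega>\<bar>)"
      using D filterlim_at_top_dense[THEN iffD1, OF filterlim_ln_inverse_at_0, rule_format, of 0]
    proof eventually_elim
      case (elim \<omega>)
      have "norm (trig_transform sin \<omega> / ln (1 / \<bar>\<omega>\<bar>)) = \<bar>trig_transform sin \<omega>\<bar> / ln (1 / \<bar>\<omega>\<bar>)"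
        unfolding real_norm_def abs_divide using elim(2) by simp
      also have "\<dots> \<le> D / ln (1 / \<bar>\<omega>\<bar>)" using elim by (intro divide_right_mono) auto
      finally show ?case .
    qed
  qed
qed

end

section \<open>The spectral density\<close>

context log_kernel
begin

abbreviation spectral_density :: "real \<Rightarrow> real \<Rightarrow> real \<Rightarrow> real" where
  "spectral_density m \<beta> \<omega> \<equiv> 1 / (2 * pi) * (2 * \<beta> * trig_transform cos \<omega> /
     ((\<beta> * trig_transform cos \<omega>)\<^sup>2 + (m * \<omega> - \<beta> * trig_transform sin \<omega>)\<^sup>2))"

text \<open>The density is homogeneous of degree -1 in the two transforms and
  \<open>m * \<omega>\<close> together (fact \<open>scale\<close>). Multiplying by the logarithm
  therefore amounts to dividing each of them by it, after which they tend to c, 0 and 0.\<close>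

lemma spectral_density_log:
  assumes "\<beta> > 0"
  shows "((\<lambda>\<omega>. spectral_density m \<beta> \<omega> * ln (1 / \<bar>\<omega>\<bar>)) \<longlongrightarrow> 1 / (pi * \<beta> * c)) (at 0)"
proof -
  let ?l = "\<lambda>\<omega>::real. ln (1 / \<bar>\<omega>\<bar>)"
  have "((\<lambda>\<omega>. m * \<omega> / ?l \<omega>) \<longlongrightarrow> 0) (at 0)"
    by (rule real_tendsto_divide_at_top[OF _ filterlim_ln_inverse_at_0]) (auto intro!: tendsto_eq_intros)
  then have "((\<lambda>\<omega>. \<beta> / pi * ((trig_transform cos \<omega> / ?l \<omega>) /
      ((\<beta> * (trig_transform cos \<omega> / ?l \<omega>))\<^sup>2 + (m * \<omega> / ?l \<omega> - \<beta> * (trig_transform sin \<omega> / ?l \<omega>))\<^sup>2)))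
      \<longlongrightarrow> \<beta> / pi * (c / ((\<beta> * c)\<^sup>2 + (0 - \<beta> * 0)\<^sup>2))) (at 0)"
    using assms c_pos by (intro tendsto_intros cos_transform_log sin_transform_log) auto
  moreover have "\<beta> / pi * (c / ((\<beta> * c)\<^sup>2 + (0 - \<beta> * 0)\<^sup>2)) = 1 / (pi * \<beta> * c)"
    using assms c_pos by (simp add: power2_eq_square)
  ultimately have "((\<lambda>\<omega>. \<beta> / pi * ((trig_transform cos \<omega> / ?l \<omega>) /
      ((\<beta> * (trig_transform cos \<omega> / ?l \<omega>))\<^sup>2 + (m * \<omega> / ?l \<omega> - \<beta> * (trig_transform sin \<omega> / ?l \<omega>))\<^sup>2)))
      \<longlongrightarrow> 1 / (pi * \<beta> * c)) (at 0)" by (simp only:)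
  moreover have "\<forall>\<^sub>F \<omega> in at 0. \<beta> / pi * ((trig_transform cos \<omega> / ?l \<omega>) /
      ((\<beta> * (trig_transform cos \<omega> / ?l \<omega>))\<^sup>2 + (m * \<omega> / ?l \<omega> - \<beta> * (trig_transform sin \<omega> / ?l \<omega>))\<^sup>2)) =
      spectral_density m \<beta> \<omega> * ?l \<omega>"
    using filterlim_at_top_dense[THEN iffD1, OF filterlim_ln_inverse_at_0, rule_format, of 0]
  proof eventually_elim
    case (elim \<omega>)
    have scale: "\<beta> / pi * (x / l / ((\<beta> * (x / l))\<^sup>2 + (z / l - \<beta> * (y / l))\<^sup>2)) =
      1 / (2 * pi) * (2 * \<beta> * x / ((\<beta> * x)\<^sup>2 + (z - \<beta> * y)\<^sup>2)) * l" if "l > 0" for x y z l :: real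
    proof -
      have "(\<beta> * (x / l))\<^sup>2 + (z / l - \<beta> * (y / l))\<^sup>2 = ((\<beta> * x)\<^sup>2 + (z - \<beta> * y)\<^sup>2) / l\<^sup>2"
        by (simp add: power_divide add_divide_distrib flip: diff_divide_distrib)
      then show ?thesis using that by (simp add: power2_eq_square)
    qed
    show ?case by (rule scale[OF elim])
  qed
  ultimately show ?thesis by (rule Lim_transform_eventually)
qed

text \<open>Both transforms are bounded by B for |\<omega>| \<ge> 1. Past the threshold (1 + \<beta>
  B) / m the inertial term exceeds \<beta> times the sine transform by at least 1, so the
  denominator is at least 1.\<close>

lemma spectral_density_bounded:
  assumes "m > 0" "\<beta> > 0"
  shows "\<exists>R B. \<forall>\<omega>. R \<le> \<bar>\<omega>\<bar> \<longrightarrow> spectral_density m \<beta> \<omega> \<le> B"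
proof -
  define B where "B = integral {0..A} (\<lambda>t. \<bar>k t\<bar>) + 4 * k A"
  have B: "\<bar>trig_transform cos \<omega>\<bar> \<le> B" "\<bar>trig_transform sin \<omega>\<bar> \<le> B" if "1 \<le> \<bar>\<omega>\<bar>" for \<omega>
    unfolding B_def using trig_transform_bounded that trig_like_cos trig_like_sin by auto
  have "spectral_density m \<beta> \<omega> \<le> 1 / (2 * pi) * (2 * \<beta> * B)" if \<omega>: "max 1 ((1 + \<beta> * B) / m) \<le> \<bar>\<omega>\<bar>" for \<omega>
  proof -
    let ?D = "(\<beta> * trig_transform cos \<omega>)\<^sup>2 + (m * \<omega> - \<beta> * trig_transform sin \<omega>)\<^sup>2"
    have "1 + \<beta> * B \<le> m * \<bar>\<omega>\<bar>"
      using \<omega> assms by (simp add: divide_le_eq mult.commute)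
    moreover have "\<bar>\<beta> * trig_transform sin \<omega>\<bar> \<le> \<beta> * B"
      using B(2)[of \<omega>] \<omega> assms by (simp add: abs_mult)
    moreover have "\<bar>m * \<omega>\<bar> = m * \<bar>\<omega>\<bar>" using assms by (simp add: abs_mult)
    ultimately have "1 \<le> \<bar>m * \<omega> - \<beta> * trig_transform sin \<omega>\<bar>" by linarith
    then have "1 \<le> (m * \<omega> - \<beta> * trig_transform sin \<omega>)\<^sup>2"
      using abs_le_square_iff[of 1 "m * \<omega> - \<beta> * trig_transform sin \<omega>"] by simp
    then have D: "1 \<le> ?D" by (simp add: add_increasing)
    have "2 * \<beta> * trig_transform cos \<omega> / ?D \<le> 2 * \<beta> * B / ?D"
      using B(1)[of \<omega>] \<omega> assms D by (intro divide_right_mono mult_left_mono) auto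
    also have "\<dots> \<le> 2 * \<beta> * B / 1"
      using B(1)[of \<omega>] \<omega> assms D by (intro divide_left_mono mult_nonneg_nonneg) auto
    finally show ?thesis by (intro mult_left_mono) auto
  qed
  then show ?thesis by blast
qed

lemma spectral_density_measurable: "spectral_density m \<beta> \<in> borel_measurable borel"
proof -
  note [measurable] = trig_transform_measurable[OF trig_like_cos] trig_transform_measurable[OF trig_like_sin]
  show ?thesis by measurable
qed

end

section \<open>From the spectral density to the variance of the position\<close>

lemma admissible_density_locally_integrable:
  fixes r :: "real \<Rightarrow> real"
  assumes [measurable]: "r \<in> borel_measurable borel" and nonneg: "\<And>\<omega>. 0 \<le> r \<omega>"
    and adm: "admissible_spectral_measure (density lborel (\<lambda>\<omega>. ennreal (r \<omega>)))"
  shows "integrable lborel (\<lambda>\<omega>. indicator {-R..R} \<omega> * r \<omega>)"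
proof -
  obtain j :: int where "integrable (density lborel (\<lambda>\<omega>. ennreal (r \<omega>))) (\<lambda>x. (1 + x\<^sup>2) powi (- j))"
    using adm by (auto simp: admissible_spectral_measure_def)
  then have j: "integrable lborel (\<lambda>\<omega>. r \<omega> * (1 + \<omega>\<^sup>2) powi (- j))"
    by (subst (asm) integrable_density) (auto simp: nonneg power_int_def)
  \<comment> \<open>The weight is at least 1 / C on {-R..R}. The exponent j may be negative or 0:
    then \<open>nat j\<close> is 0, C is 1, and the weight is at least 1 by itself.\<close>
  define C where "C = (1 + R\<^sup>2) ^ nat j"
  have C: "0 < C" unfolding C_def by (intro zero_less_power) (simp add: add_pos_nonneg)
  show ?thesis
  proof (rule Bochner_Integration.integrable_bound[OF integrable_mult_right[OF j, of C]])
    show "AE \<omega> in lborel. norm (indicator {-R..R} \<omega> * r \<omega>) \<le> norm (C * (r \<omega> * (1 + \<omega>\<^sup>2) powi (- j)))"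
    proof (rule AE_I2)
      fix \<omega>
      show "norm (indicator {-R..R} \<omega> * r \<omega>) \<le> norm (C * (r \<omega> * (1 + \<omega>\<^sup>2) powi (- j)))"
      proof (cases "\<omega> \<in> {-R..R}")
        case True
        then have "\<omega>\<^sup>2 \<le> R\<^sup>2" by (intro abs_le_square_iff[THEN iffD1]) auto
        have y: "1 \<le> 1 + \<omega>\<^sup>2" by simp
        have pos: "0 < (1 + \<omega>\<^sup>2) powi (- j)" using y by (intro zero_less_power_int) linarith
        have "1 \<le> C * (1 + \<omega>\<^sup>2) powi (- j)"
        proof (cases "j \<le> 0")
          case True
          then have "(1 + \<omega>\<^sup>2) powi (- j) = (1 + \<omega>\<^sup>2) ^ nat (- j)" by (simp add: power_int_def)
          then show ?thesis using True y by (simp add: C_def one_le_power)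
        next
          case False
          then have "(1 + \<omega>\<^sup>2) powi (- j) = inverse ((1 + \<omega>\<^sup>2) ^ nat j)"
            by (simp add: power_int_def power_inverse)
          moreover have "(1 + \<omega>\<^sup>2) ^ nat j \<le> C"
            unfolding C_def using \<open>\<omega>\<^sup>2 \<le> R\<^sup>2\<close> by (intro power_mono) auto
          moreover have "0 < (1 + \<omega>\<^sup>2) ^ nat j" using y by (intro zero_less_power) linarith
          ultimately show ?thesis by (simp add: field_simps)
        qed
        then have "r \<omega> * 1 \<le> r \<omega> * (C * (1 + \<omega>\<^sup>2) powi (- j))"
          by (intro mult_left_mono nonneg)
        moreover have "0 \<le> C * (r \<omega> * (1 + \<omega>\<^sup>2) powi (- j))"
          using C pos nonneg by simp
        ultimately show ?thesis using True nonneg by (simp add: mult_ac)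
      qed simp
    qed
  qed measurable
qed

text \<open>The covariance identity with both arguments equal to the indicator. The integrability
  hypothesis is what places the transform in \<open>L2\<close> and hence the indicator in the
  operator domain.\<close>

lemma position_process_variance:
  assumes r [measurable]: "r \<in> borel_measurable borel" and nonneg: "\<And>\<omega>. 0 \<le> r \<omega>"
    and V: "operator_with_spectral_measure M (density lborel (\<lambda>\<omega>. ennreal (r \<omega>))) V"
    and t: "0 \<le> t"
    and int: "integrable lborel (\<lambda>\<omega>. 2 * (1 - cos (t * \<omega>)) / \<omega>\<^sup>2 * r \<omega>)"
  shows "(LINT w|M. (norm (position_process V t w))\<^sup>2) = (LINT \<omega>|lborel. 2 * (1 - cos (t * \<omega>)) / \<omega>\<^sup>2 * r \<omega>)"
proof -
  let ?\<nu> = "density lborel (\<lambda>\<omega>. ennreal (r \<omega>))"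
  let ?g = "distribution_of (indicator {0..t})"
  let ?h = "fourier (indicator {0..t})"
  have ae: "AE \<omega> in lborel. r \<omega> * (norm (?h \<omega>))\<^sup>2 = 2 * (1 - cos (t * \<omega>)) / \<omega>\<^sup>2 * r \<omega>"
    using AE_lborel_singleton[of "0::real"] by eventually_elim (simp add: norm_fourier_indicator[OF t])
  have "integrable lborel (\<lambda>\<omega>. r \<omega> * (norm (?h \<omega>))\<^sup>2)"
    by (subst integrable_cong_AE[OF _ _ ae]) (use int in auto)
  then have h: "?h \<in> L2 ?\<nu>"
    by (simp add: L2_def integrable_density nonneg)
  have g: "?g \<in> operator_domain ?\<nu>"
    using h fourier_distribution_indicator[OF t] indicator_tempered_distribution[OF t]
    by (auto simp: operator_domain_def)
  have "(LINT w|M. V ?g w * cnj (V ?g w)) = (LINT \<omega>|?\<nu>. ?h \<omega> * cnj (?h \<omega>))"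
    using V g h fourier_distribution_indicator[OF t]
    unfolding operator_with_spectral_measure_def by blast
  then have "(LINT w|M. (norm (V ?g w))\<^sup>2) = (LINT \<omega>|?\<nu>. (norm (?h \<omega>))\<^sup>2)"
    unfolding complex_norm_square[symmetric] integral_complex_of_real of_real_eq_iff .
  also have "\<dots> = (LINT \<omega>|lborel. r \<omega> * (norm (?h \<omega>))\<^sup>2)"
    by (simp add: integral_density nonneg)
  also have "\<dots> = (LINT \<omega>|lborel. 2 * (1 - cos (t * \<omega>)) / \<omega>\<^sup>2 * r \<omega>)"
    by (rule integral_cong_AE[OF _ _ ae]) auto
  finally show ?thesis by (simp add: position_process_def)
qed

text \<open>The start \<open>max 1 A\<close> stays away from 0, where K may be \<infinity>:
  \<open>real_of_ereal\<close> sends \<infinity> to 0, which would destroy monotonicity.\<close>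

lemma log_kernelI:
  fixes K :: "real \<Rightarrow> ereal"
  assumes range: "\<And>t. K t \<noteq> -\<infinity>" "\<And>t. t \<noteq> 0 \<Longrightarrow> K t \<noteq> \<infinity>"
    and int: "locally_integrable (\<lambda>t. real_of_ereal (K t))"
    and pos: "\<And>t. t \<noteq> 0 \<Longrightarrow> K t > 0"
    and anti: "antimono_on {A..} K"
    and c: "c > 0" "((\<lambda>t. real_of_ereal (K t) / (1 / t)) \<longlongrightarrow> c) at_top"
  shows "log_kernel (\<lambda>t. real_of_ereal (K t)) (max 1 A) c"
proof
  show "antimono_on {max 1 A..} (\<lambda>t. real_of_ereal (K t))"
  proof (rule monotone_onI)
    fix x y assume xy: "x \<in> {max 1 A..}" "y \<in> {max 1 A..}" "x \<le> y"
    then have "K y \<le> K x" by (intro monotone_onD[OF anti]) auto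
    then show "real_of_ereal (K y) \<le> real_of_ereal (K x)"
      using xy range(1)[of y] range(2)[of x] pos[of x] pos[of y]
      by (intro real_of_ereal_positive_mono) auto
  qed
  show "0 \<le> real_of_ereal (K t)" if "max 1 A \<le> t" for t
    using pos[of t] that by (intro real_of_ereal_pos) auto
  show "((\<lambda>t. real_of_ereal (K t) * t) \<longlongrightarrow> c) at_top"
    using c(2) by simp
qed (use int c in auto)

theorem theorem2p2:
  fixes K :: "real \<Rightarrow> ereal" and m \<beta> :: real
    and M :: "'w measure" and V :: "functional \<Rightarrow> 'w \<Rightarrow> complex"
  assumes range: "\<And>t. K t \<noteq> -\<infinity>" "\<And>t. t \<noteq> 0 \<Longrightarrow> K t \<noteq> \<infinity>"
    and Ia: "locally_integrable (\<lambda>t. real_of_ereal (K t))"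
            "\<And>t. K (- t) = K t"
            "\<And>t. t \<noteq> 0 \<Longrightarrow> K t > 0"
    and Ib: "(K \<longlongrightarrow> 0) at_top" "\<exists>A. antimono_on {A..} K"
    and Ic: "\<And>\<omega>. \<omega> \<noteq> 0 \<Longrightarrow> K_cos K \<omega> > 0"
    and II: "(\<lambda>t. real_of_ereal (K t)) \<asymp>\<^sub>c (\<lambda>t. 1 / t)"
    and pos: "m > 0" "\<beta> > 0"
    and V: "operator_with_spectral_measure M
              (density lborel (\<lambda>\<omega>. ennreal (r_hat m \<beta> K \<omega>))) V"
  shows "(\<lambda>t. LINT w|M. (norm (position_process V t w))\<^sup>2) \<asymp>\<^sub>c (\<lambda>t. t / ln t)"
proof -
  obtain A where A: "antimono_on {A..} K" using Ib(2) by blast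
  obtain c where c: "c > 0" "((\<lambda>t. real_of_ereal (K t) / (1 / t)) \<longlongrightarrow> c) at_top"
    using II by (auto simp: asymp_const_def)
  interpret log_kernel "\<lambda>t. real_of_ereal (K t)" "max 1 A" c
    by (rule log_kernelI[OF range Ia(1,3) A c])
  \<comment> \<open>Equality of functions, including \<omega> = 0, since both sides are the same
    \<open>Lim\<close> expression even where it diverges.\<close>
  have "trig_transform cos = K_cos K" "trig_transform sin = K_sin K"
    by (auto simp: trig_transform_def K_cos_def K_sin_def)
  then have r_hat: "spectral_density m \<beta> \<omega> = r_hat m \<beta> K \<omega>" for \<omega>
    by (simp add: r_hat_def)
  note meas = spectral_density_measurable[where m=m and \<beta>=\<beta>, unfolded r_hat]
    and lim = spectral_density_log[OF pos(2), where m=m, unfolded r_hat]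
  obtain R B where RB: "\<And>\<omega>. R \<le> \<bar>\<omega>\<bar> \<Longrightarrow> r_hat m \<beta> K \<omega> \<le> B"
    using spectral_density_bounded[OF pos] unfolding r_hat by blast
  \<comment> \<open>\<open>r_hat m \<beta> K 0\<close> may be negative, as \<open>K_cos K 0\<close> is unspecified; \<open>ennreal\<close> truncates it anyway.\<close>
  define r where "r = (\<lambda>\<omega>. max 0 (r_hat m \<beta> K \<omega>))"
  have r: "r \<omega> = r_hat m \<beta> K \<omega>" if "\<omega> \<noteq> 0" for \<omega>
    using Ic[OF that] pos unfolding r_def r_hat_def
    by (intro max_absorb2 mult_nonneg_nonneg divide_nonneg_nonneg add_nonneg_nonneg) auto
  have r_meas: "r \<in> borel_measurable borel" and r_nonneg: "\<And>\<omega>. 0 \<le> r \<omega>"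
    using meas by (auto simp: r_def)
  have "ennreal (r_hat m \<beta> K \<omega>) = ennreal (r \<omega>)" for \<omega>
    by (cases "0 \<le> r_hat m \<beta> K \<omega>") (simp_all add: r_def ennreal_neg max_absorb2 max_absorb1)
  from V[unfolded this] have V': "operator_with_spectral_measure M (density lborel (\<lambda>\<omega>. ennreal (r \<omega>))) V" .
  \<comment> \<open>Admissibility of the spectral measure is part of what \<open>V\<close> being its
    operator means.\<close>
  then have loc: "integrable lborel (\<lambda>\<omega>. indicator {-R..R} \<omega> * r \<omega>)" for R
    by (intro admissible_density_locally_integrable[OF r_meas r_nonneg])
      (simp add: operator_with_spectral_measure_def)
  have bdd: "r \<omega> \<le> max 0 B" if "R \<le> \<bar>\<omega>\<bar>" for \<omega>
    using RB[OF that] by (auto simp: r_def)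
  \<comment> \<open>A limit at 0 ignores the value at 0, the one point where \<open>r\<close> and
    \<open>r_hat\<close> may differ.\<close>
  have lim_r: "((\<lambda>\<omega>. r \<omega> * ln (1 / \<bar>\<omega>\<bar>)) \<longlongrightarrow> 1 / (pi * \<beta> * c)) (at 0)"
    using lim by (rule Lim_transform_eventually) (simp add: eventually_at_filter r)
  have "1 / (pi * \<beta> * c) > 0" using pos c by simp
  note asymp = spectral_integral_asymp[OF r_meas r_nonneg loc bdd lim_r this]
  obtain C where C: "C > 0" "((\<lambda>t. (LINT \<omega>|lborel. 2 * (1 - cos (t * \<omega>)) / \<omega>\<^sup>2 * r \<omega>) / (t / ln t)) \<longlongrightarrow> C) at_top"
    using asymp(2) unfolding asymp_const_def by blast
  have "((\<lambda>t. (LINT w|M. (norm (position_process V t w))\<^sup>2) / (t / ln t)) \<longlongrightarrow> C) at_top"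
    using C(2)
  proof (rule Lim_transform_eventually)
    show "\<forall>\<^sub>F t in at_top. (LINT \<omega>|lborel. 2 * (1 - cos (t * \<omega>)) / \<omega>\<^sup>2 * r \<omega>) / (t / ln t) =
      (LINT w|M. (norm (position_process V t w))\<^sup>2) / (t / ln t)"
      using eventually_ge_at_top[of 0]
      by eventually_elim (simp only: position_process_variance[OF r_meas r_nonneg V' _ asymp(1)])
  qed
  with C(1) show ?thesis unfolding asymp_const_def by blast
qed

end
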